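(* Let $\mathcal{M}_n$ denote the set of all planar maps with $n$ vertices and, for $M\in\mathcal{M}_n$, let $\mathcal{E}(M)$ be the set of Eulerian orientations of $M$. Then, for $n$ big enough, $$2.59^n\le \max_{M\in\mathcal{M}_n}|\mathcal{E}(M)|\le 3.73^n .$$
   Context: A planar map is a finite simple planar graph together with a fixed crossing-free embedding in the Euclidean plane. An Eulerian orientation of $M$ is an orientation of the edges of $M$ in which every vertex $v$ has out-degree $d(v)/2$, where $d(v)$ is the degree of $v$ (so $\mathcal{E}(M)$ is empty unless all degrees are even). *)

theory Defs
  imports "HOL-Analysis.Analysis"
begin

(* The Euclidean plane is the type complex.  The field arc_of is only relevant on the edges. *)
record 'v planar_map =
  verts :: "'v set"
  edges :: "'v set set"
  point_of :: "'v \<Rightarrow> complex"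
  arc_of :: "'v set \<Rightarrow> real \<Rightarrow> complex"

definition simple_graph :: "'v set \<Rightarrow> 'v set set \<Rightarrow> bool" where
  "simple_graph V E \<longleftrightarrow>
     finite V \<and> (\<forall>e\<in>E. \<exists>u\<in>V. \<exists>v\<in>V. u \<noteq> v \<and> e = {u, v})"

definition plane_embedding ::
  "'v set \<Rightarrow> 'v set set \<Rightarrow> ('v \<Rightarrow> complex) \<Rightarrow> ('v set \<Rightarrow> real \<Rightarrow> complex) \<Rightarrow> bool" where
  "plane_embedding V E p \<gamma> \<longleftrightarrow>
     inj_on p V \<and>
     (\<forall>e\<in>E. arc (\<gamma> e) \<and> {pathstart (\<gamma> e), pathfinish (\<gamma> e)} = p ` e) \<and>
     (\<forall>e\<in>E. \<forall>v\<in>V. p v \<in> path_image (\<gamma> e) \<longrightarrow> v \<in> e) \<and>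
     (\<forall>e\<in>E. \<forall>f\<in>E. e \<noteq> f \<longrightarrow>
        path_image (\<gamma> e) \<inter> path_image (\<gamma> f) \<subseteq> p ` (e \<inter> f))"

definition is_planar_map :: "'v planar_map \<Rightarrow> bool" where
  "is_planar_map M \<longleftrightarrow>
     simple_graph (verts M) (edges M) \<and>
     plane_embedding (verts M) (edges M) (point_of M) (arc_of M)"

(* Vertices are labelled by natural numbers; maps need not be connected.
   The number of Eulerian orientations does not depend on the labels. *)
definition planar_maps :: "nat \<Rightarrow> nat planar_map set" where
  "planar_maps n = {M. is_planar_map M \<and> card (verts M) = n}"

definition vertex_degree :: "'v planar_map \<Rightarrow> 'v \<Rightarrow> nat" where
  "vertex_degree M v = card {e \<in> edges M. v \<in> e}"

definition orientation :: "'v planar_map \<Rightarrow> ('v \<times> 'v) set \<Rightarrow> bool" where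
  "orientation M A \<longleftrightarrow>
     (\<forall>(u, v)\<in>A. {u, v} \<in> edges M) \<and>
     (\<forall>u v. {u, v} \<in> edges M \<longrightarrow> ((u, v) \<in> A \<longleftrightarrow> (v, u) \<notin> A))"

definition out_degree :: "('v \<times> 'v) set \<Rightarrow> 'v \<Rightarrow> nat" where
  "out_degree A v = card {w. (v, w) \<in> A}"

definition eulerian_orientations :: "'v planar_map \<Rightarrow> ('v \<times> 'v) set set" where
  "eulerian_orientations M =
     {A. orientation M A \<and> (\<forall>v\<in>verts M. real (out_degree A v) = real (vertex_degree M v) / 2)}"

definition max_eulerian_orientations :: "nat \<Rightarrow> nat" where
  "max_eulerian_orientations n = Max ((\<lambda>M. card (eulerian_orientations M)) ` planar_maps n)"

(* There are infinitely many embeddings, but the numbers of Eulerian orientations form a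
   finite nonempty set, so that Max above is a genuine maximum. *)
lemma eulerian_orientations_subset:
  assumes "is_planar_map M"
  shows "eulerian_orientations M \<subseteq> Pow (verts M \<times> verts M)"
proof (intro subsetI PowI)
  fix A and x :: "'a \<times> 'a"
  assume A: "A \<in> eulerian_orientations M" and x: "x \<in> A"
  obtain u v where uv: "x = (u, v)" by (cases x)
  have "{u, v} \<in> edges M"
    using A x uv by (auto simp: eulerian_orientations_def orientation_def)
  then obtain a b where "a \<in> verts M" "b \<in> verts M" "{u, v} = {a, b}"
    using assms unfolding is_planar_map_def simple_graph_def by blast
  then show "x \<in> verts M \<times> verts M"
    unfolding uv by (auto simp: doubleton_eq_iff)
qed

lemma finite_eulerian_orientation_numbers:
  "finite ((\<lambda>M. card (eulerian_orientations M)) ` planar_maps n)"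
proof (rule finite_subset)
  show "(\<lambda>M. card (eulerian_orientations M)) ` planar_maps n \<subseteq> {..2 ^ (n * n)}"
  proof (rule image_subsetI)
    fix M :: "nat planar_map" assume "M \<in> planar_maps n"
    then have M: "is_planar_map M" "card (verts M) = n"
      by (auto simp: planar_maps_def)
    then have fin: "finite (verts M)"
      by (simp add: is_planar_map_def simple_graph_def)
    have "card (eulerian_orientations M) \<le> card (Pow (verts M \<times> verts M))"
      using fin eulerian_orientations_subset[OF M(1)] by (intro card_mono) auto
    then show "card (eulerian_orientations M) \<in> {..2 ^ (n * n)}"
      using fin M(2) by (simp add: card_Pow card_cartesian_product)
  qed
qed simp

lemma planar_maps_nonempty: "planar_maps n \<noteq> {}"
proof -
  have "\<lparr>verts = {..<n}, edges = {}, point_of = of_nat, arc_of = (\<lambda>e t. 0)\<rparr> \<in> planar_maps n"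
    by (simp add: planar_maps_def is_planar_map_def simple_graph_def plane_embedding_def
        inj_on_def)
  then show ?thesis by blast
qed

end

theory Submission
  imports Defs
begin

text \<open>
  For the upper bound, let \<open>N\<close> be the number of orientations of a graph with \<open>n\<close> vertices, \<open>m\<close> edges and
  \<open>\<kappa>\<close> connected components in which every vertex has a prescribed out-degree.  If every subgraph has a
  vertex of degree at most 5, then \<open>N \<le> (7/4)^m / (3/2)^(n - \<kappa>)\<close>.  To see this, delete such a vertex
  \<open>v\<close>.  For a component \<open>W\<close> of the remaining graph, the out-degrees in \<open>W\<close> determine how many of the
  \<open>k\<close> edges between \<open>v\<close> and \<open>W\<close> point away from \<open>v\<close>: the arrows starting in \<open>W\<close> are one for each edge
  inside \<open>W\<close> and those from \<open>W\<close> to \<open>v\<close>.  These edges can thus be oriented in at most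
  \<open>k choose (k div 2) \<le> (7/4)^k / (3/2)\<close> ways for \<open>1 \<le> k \<le> 5\<close>, and \<open>n - \<kappa>\<close> drops by exactly the
  number of components \<open>W\<close> that are adjacent to \<open>v\<close>.  So the factors fit together
  (\<open>card_orientations_with_out_degrees_le\<close>).

  A planar map has \<open>m \<le> 3 (n - \<kappa>)\<close> (\<open>plane_graph_card_edges_le\<close>), and so do its subgraphs, which
  therefore have vertices of degree at most 5.  Hence
  \<open>N \<le> ((7/4)^3 / (3/2))^(n - \<kappa>) \<le> 3.58^n\<close>.
  The edge bound holds for drawings with arbitrary arcs.  A bridge is removed by induction.  Without
  bridges every edge lies on a closed curve of the drawing.  By the Jordan curve theorem, an edge that
  closes a cycle splits a face, so there are at least \<open>1 + m - n + \<kappa>\<close> faces.  By Janiszewski's theorem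
  an edge touches at most one face on each side of such a curve; and a face touches at least three edges
  (if there are three), because two arcs with at most one common point do not separate the plane.

  For the lower bound, join the integers \<open>0, \<dots>, n - 1\<close> whenever they differ by at most 3, and omit two edges at
  the ends to make all degrees even.  With the integers placed on three rays in turn, at increasing
  distance, the straight edges do not cross: they form a triangulated strip that winds
  around the origin.  Scanning the vertices in order, an Eulerian orientation is a walk on six states, where a state records how many of the arrows across the
  current cut enter each of the next three vertices.  The number of walks grows like the powers of
  the largest root \<open>2.769\<dots>\<close> of \<open>x^3 - 3 x^2 + x - 1\<close>; the weights \<open>3, 10, 7, 7, 10, 3\<close> on the states
  certify a growth rate of at least \<open>2.7\<close> (\<open>card_flow_runs_ge\<close>).
\<close>

section \<open>Connected components of a graph\<close>

definition linked :: "'v set set \<Rightarrow> ('v \<times> 'v) set" where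
  "linked E = {(u, v). {u, v} \<in> E}\<^sup>*"

definition graph_components :: "'v set \<Rightarrow> 'v set set \<Rightarrow> 'v set set" where
  "graph_components V E = V // linked E"

lemma equiv_linked: "equiv UNIV (linked E)"
proof (rule equivI)
  have "sym {(u, v). {u, v} \<in> E}" by (auto simp: sym_def insert_commute)
  then show "sym (linked E)" unfolding linked_def by (rule sym_rtrancl)
qed (auto simp: linked_def refl_rtrancl trans_rtrancl)

lemma linked_refl [simp]: "(a, a) \<in> linked E"
  by (simp add: linked_def)

lemma linked_trans: "(a, b) \<in> linked E \<Longrightarrow> (b, c) \<in> linked E \<Longrightarrow> (a, c) \<in> linked E"
  unfolding linked_def by (rule rtrancl_trans)

lemma linked_mono: "E \<subseteq> E' \<Longrightarrow> linked E \<subseteq> linked E'"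
  unfolding linked_def by (rule rtrancl_mono) auto

lemma linked_edge: "{a, b} \<in> E \<Longrightarrow> (a, b) \<in> linked E"
  unfolding linked_def by (rule r_into_rtrancl) auto

lemma simple_graph_edgeE:
  assumes "simple_graph V E" "e \<in> E"
  obtains u v where "u \<in> V" "v \<in> V" "u \<noteq> v" "e = {u, v}"
  using assms unfolding simple_graph_def by blast

lemma simple_graph_neighbour:
  assumes "simple_graph V E" "{u, v} \<in> E"
  shows "u \<in> V" "v \<in> V" "u \<noteq> v"
proof -
  obtain a b where "a \<in> V" "b \<in> V" "a \<noteq> b" "{u, v} = {a, b}"
    using simple_graph_edgeE[OF assms] .
  then show "u \<in> V" "v \<in> V" "u \<noteq> v" by (auto simp: doubleton_eq_iff)
qed

lemma simple_graph_edge_subset: "simple_graph V E \<Longrightarrow> e \<in> E \<Longrightarrow> e \<subseteq> V"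
  by (elim simple_graph_edgeE) auto

lemma simple_graph_finite_edges: "simple_graph V E \<Longrightarrow> finite E"
  by (rule finite_subset[of _ "Pow V"])
    (auto simp: simple_graph_def dest!: simple_graph_edge_subset)

lemma simple_graph_subset: "simple_graph V E \<Longrightarrow> F \<subseteq> E \<Longrightarrow> simple_graph V F"
  unfolding simple_graph_def by blast

lemma linked_in_verts:
  assumes "simple_graph V E" "(a, b) \<in> linked E" "a \<in> V"
  shows "b \<in> V"
  using assms(2,3) unfolding linked_def
proof (induction rule: rtrancl_induct)
  case (step y z)
  then show ?case using simple_graph_neighbour(2)[OF assms(1)] by blast
qed

lemma finite_graph_components: "finite V \<Longrightarrow> finite (graph_components V E)"
  by (simp add: graph_components_def quotient_def)

lemma graph_components_coarsen:
  assumes "E \<subseteq> E'"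
  shows "graph_components V E' = (``) (linked E') ` graph_components V E"
proof -
  have "linked E' `` (linked E `` {x}) = linked E' `` {x}" for x
    using linked_mono[OF assms] linked_trans[of x _ E'] by auto
  then show ?thesis
    unfolding graph_components_def quotient_def by auto
qed

lemma card_graph_components_mono:
  assumes "finite V" "E \<subseteq> E'"
  shows "card (graph_components V E') \<le> card (graph_components V E)"
  unfolding graph_components_coarsen[OF assms(2)]
  by (rule card_image_le[OF finite_graph_components[OF assms(1)]])

text \<open>
  An edge between two components merges them, so the map from the old components onto the new ones
  is not injective.
\<close>

lemma card_graph_components_join:
  assumes V: "finite V" and ab: "a \<in> V" "b \<in> V" "(a, b) \<notin> linked E"
    and sub: "insert {a, b} E \<subseteq> E'"
  shows "card (graph_components V E') < card (graph_components V E)"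
proof -
  let ?h = "(``) (linked E')"
  let ?a = "linked E `` {a}" and ?b = "linked E `` {b}"
  have ab_in: "?a \<in> graph_components V E" "?b \<in> graph_components V E"
    using ab by (auto simp: graph_components_def quotient_def)
  have "b \<in> ?b" "b \<notin> ?a" using ab(3) by simp_all
  then have "?a \<noteq> ?b" by blast
  have hh: "linked E' `` (linked E `` {x}) = linked E' `` {x}" for x
    using linked_mono[of E E'] sub linked_trans[of x _ E'] by auto
  have "(a, b) \<in> linked E'" using sub by (intro linked_edge) auto
  then have "?h ?a = ?h ?b"
    unfolding hh by (rule equiv_class_eq[OF equiv_linked])
  then have "\<not> inj_on ?h (graph_components V E)"
    using ab_in \<open>?a \<noteq> ?b\<close> unfolding inj_on_def by blast
  moreover have fin: "finite (graph_components V E)" by (rule finite_graph_components[OF V])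
  ultimately have "card (?h ` graph_components V E) \<noteq> card (graph_components V E)"
    using inj_on_iff_eq_card by blast
  moreover have "card (?h ` graph_components V E) \<le> card (graph_components V E)"
    by (rule card_image_le[OF fin])
  ultimately show ?thesis using graph_components_coarsen[of E E' V] sub by simp
qed

lemma graph_component_subset:
  assumes "simple_graph V E" "W \<in> graph_components V E"
  shows "W \<subseteq> V"
  using assms linked_in_verts[OF assms(1)]
  unfolding graph_components_def quotient_def by auto

lemma graph_component_closed:
  assumes "W \<in> graph_components V E" "x \<in> W" "{x, y} \<in> E"
  shows "y \<in> W"
  using assms(1,2) linked_trans[OF _ linked_edge[OF assms(3)]]
  unfolding graph_components_def quotient_def by auto

lemma graph_components_disjoint:
  assumes "W \<in> graph_components V E" "W' \<in> graph_components V E" "x \<in> W" "x \<in> W'"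
  shows "W = W'"
proof -
  obtain a b where ab: "W = linked E `` {a}" "W' = linked E `` {b}"
    using assms(1,2) unfolding graph_components_def quotient_def by auto
  then have "W = linked E `` {x}" "W' = linked E `` {x}"
    using assms(3,4) by (simp_all add: equiv_class_eq[OF equiv_linked])
  then show ?thesis by simp
qed

lemma Union_graph_components:
  assumes "simple_graph V E"
  shows "\<Union>(graph_components V E) = V"
proof
  show "\<Union>(graph_components V E) \<subseteq> V" using graph_component_subset[OF assms] by blast
  show "V \<subseteq> \<Union>(graph_components V E)"
  proof
    fix x assume "x \<in> V"
    then have "linked E `` {x} \<in> graph_components V E"
      unfolding graph_components_def by (rule quotientI)
    moreover have "x \<in> linked E `` {x}" by simp
    ultimately show "x \<in> \<Union>(graph_components V E)" by blast
  qed
qed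

text \<open>
  Deleting \<open>v\<close> replaces the component of \<open>v\<close> by the pieces that contain neighbours of \<open>v\<close>; every other
  piece was a component before.
\<close>

lemma card_graph_components_delete_vertex:
  fixes V :: "'v set"
  assumes V: "finite V" "v \<in> V"
    and G: "simple_graph (V - {v}) E0" "E0 = {e \<in> E. v \<notin> e}"
    and N: "N = {w. {v, w} \<in> E}"
  shows "card (graph_components (V - {v}) E0) + 1
    \<le> card (graph_components V E) + card {W \<in> graph_components (V - {v}) E0. W \<inter> N \<noteq> {}}"
proof -
  let ?Cs = "graph_components (V - {v}) E0"
  let ?W = "{W \<in> ?Cs. W \<inter> N \<noteq> {}}"
  have fin: "finite ?Cs" using V by (intro finite_graph_components) auto
  have same: "W \<in> graph_components V E" if W: "W \<in> ?Cs" "W \<inter> N = {}" for W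
  proof -
    obtain u where u: "u \<in> V - {v}" "W = linked E0 `` {u}"
      using W(1) unfolding graph_components_def quotient_def by auto
    have "x \<in> W" if "(u, x) \<in> linked E" for x
      using that unfolding linked_def
    proof (induction rule: rtrancl_induct)
      case base
      show ?case using u by simp
    next
      case (step y z)
      have yz: "{y, z} \<in> E" using step by auto
      have "y \<noteq> v" using graph_component_subset[OF G(1) W(1)] step by auto
      moreover have "z \<noteq> v" using yz W(2) step N by (auto simp: insert_commute)
      ultimately have "{y, z} \<in> E0" using yz G(2) by auto
      then show ?case using graph_component_closed[OF W(1)] step by blast
    qed
    then have "W = linked E `` {u}"
      using u(2) linked_mono[of E0 E] G(2) by auto
    then show ?thesis using u(1) unfolding graph_components_def quotient_def by auto
  qed
  let ?v = "linked E `` {v}"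
  have "?v \<in> graph_components V E"
    using V(2) unfolding graph_components_def quotient_def by auto
  then have "insert ?v (?Cs - ?W) \<subseteq> graph_components V E" using same by auto
  then have "card (insert ?v (?Cs - ?W)) \<le> card (graph_components V E)"
    using V by (intro card_mono finite_graph_components)
  moreover have "?v \<notin> ?Cs"
  proof
    assume "?v \<in> ?Cs"
    then have "?v \<subseteq> V - {v}" by (rule graph_component_subset[OF G(1)])
    moreover have "v \<in> ?v" by simp
    ultimately show False by blast
  qed
  then have "card (insert ?v (?Cs - ?W)) = card (?Cs - ?W) + 1" using fin by simp
  moreover have "card (?Cs - ?W) = card ?Cs - card ?W" by (intro card_Diff_subset) (use fin in auto)
  moreover have "card ?W \<le> card ?Cs" using fin by (intro card_mono) auto
  ultimately show ?thesis by linarith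
qed

section \<open>Orientations with prescribed out-degrees\<close>

definition orientations_with_out_degrees ::
  "'v set set \<Rightarrow> 'v set \<Rightarrow> ('v \<Rightarrow> nat) \<Rightarrow> ('v \<times> 'v) set set" where
  "orientations_with_out_degrees E V \<alpha> =
     {A. (\<forall>(u, v)\<in>A. {u, v} \<in> E) \<and> (\<forall>u v. {u, v} \<in> E \<longrightarrow> ((u, v) \<in> A \<longleftrightarrow> (v, u) \<notin> A)) \<and>
         (\<forall>v\<in>V. out_degree A v = \<alpha> v)}"

lemma orientations_subset:
  assumes "simple_graph V E" "A \<in> orientations_with_out_degrees E V \<alpha>"
  shows "A \<subseteq> V \<times> V"
  using assms simple_graph_neighbour[OF assms(1)]
  unfolding orientations_with_out_degrees_def by fast

lemma finite_orientations:
  assumes "simple_graph V E"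
  shows "finite (orientations_with_out_degrees E V \<alpha>)"
  by (rule finite_subset[of _ "Pow (V \<times> V)"])
    (use orientations_subset[OF assms] assms in \<open>auto simp: simple_graph_def\<close>)

text \<open>
  The arrows that start in \<open>W\<close> are counted by their tails: each edge inside \<open>W\<close> contributes one, whatever
  its direction.  So the number of arrows from \<open>W\<close> to \<open>v\<close> is the same for all orientations in question.
\<close>

lemma sum_out_degree_component:
  assumes G: "simple_graph V E" and A: "A \<in> orientations_with_out_degrees E V \<alpha>"
    and W: "W \<subseteq> V" "v \<notin> W"
    and closed: "\<And>x y. x \<in> W \<Longrightarrow> {x, y} \<in> E \<Longrightarrow> y \<in> insert v W"
  shows "(\<Sum>w\<in>W. \<alpha> w) = card {e \<in> E. e \<subseteq> W} + card {w \<in> W. (w, v) \<in> A}"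
proof -
  have finV: "finite V" using G by (simp add: simple_graph_def)
  have finW: "finite W" using W finV finite_subset by blast
  have edge: "{x, y} \<in> E" if "(x, y) \<in> A" for x y
    using A that unfolding orientations_with_out_degrees_def by auto
  have antisym: "(x, y) \<in> A \<longleftrightarrow> (y, x) \<notin> A" if "{x, y} \<in> E" for x y
    using A that unfolding orientations_with_out_degrees_def by auto
  have out: "\<alpha> w = card {x \<in> W. (w, x) \<in> A} + (if (w, v) \<in> A then 1 else 0)" if w: "w \<in> W" for w
  proof -
    have "{x. (w, x) \<in> A} = {x \<in> W. (w, x) \<in> A} \<union> (if (w, v) \<in> A then {v} else {})"
      using closed[OF w] edge by auto
    also have "card \<dots> = card {x \<in> W. (w, x) \<in> A} + (if (w, v) \<in> A then 1 else 0)"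
      using W finW by auto
    finally show ?thesis
      using A w W(1) unfolding orientations_with_out_degrees_def out_degree_def by auto
  qed
  have "(\<Sum>w\<in>W. \<alpha> w) = (\<Sum>w\<in>W. card {x \<in> W. (w, x) \<in> A}) + (\<Sum>w\<in>W. if (w, v) \<in> A then 1 else 0)"
    using out by (simp add: sum.distrib)
  also have "(\<Sum>w\<in>W. if (w, v) \<in> A then 1 else 0) = card {w \<in> W. (w, v) \<in> A}"
    using finW by (simp add: sum.If_cases Int_def)
  also have "(\<Sum>w\<in>W. card {x \<in> W. (w, x) \<in> A}) = card (SIGMA w:W. {x \<in> W. (w, x) \<in> A})"
    using finW by (intro card_SigmaI[symmetric]) auto
  also have "\<dots> = card {e \<in> E. e \<subseteq> W}"
  proof (rule bij_betw_same_card)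
    show "bij_betw (\<lambda>(x, y). {x, y}) (SIGMA w:W. {x \<in> W. (w, x) \<in> A}) {e \<in> E. e \<subseteq> W}"
      unfolding bij_betw_def
    proof
      show "inj_on (\<lambda>(x, y). {x, y}) (SIGMA w:W. {x \<in> W. (w, x) \<in> A})"
        using edge antisym by (auto simp: inj_on_def doubleton_eq_iff)
      show "(\<lambda>(x, y). {x, y}) ` (SIGMA w:W. {x \<in> W. (w, x) \<in> A}) = {e \<in> E. e \<subseteq> W}"
      proof (intro equalityI subsetI)
        fix e assume e: "e \<in> {e \<in> E. e \<subseteq> W}"
        then obtain x y where xy: "e = {x, y}" using simple_graph_edgeE[OF G] by blast
        then have "(x, y) \<in> A \<or> (y, x) \<in> A" using antisym e by blast
        then show "e \<in> (\<lambda>(x, y). {x, y}) ` (SIGMA w:W. {x \<in> W. (w, x) \<in> A})"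
          using e xy by (auto simp: image_iff insert_commute)
      qed (use edge in auto)
    qed
  qed
  finally show ?thesis .
qed

text \<open>
  This fixes the weights \<open>7/4\<close> per edge and \<open>3/2\<close> per unit of \<open>n - \<kappa>\<close>.  The inequality fails for
  \<open>k = 0\<close>, which is why only the components adjacent to the deleted vertex may be charged, and for \<open>k = 6\<close>,
  which is why vertices of degree at most 5 are deleted.
\<close>

lemma binomial_le_weight:
  assumes "1 \<le> k" "k \<le> 5"
  shows "real (k choose c) \<le> (7/4)^k / (3/2)"
proof -
  have "real (k choose c) \<le> real (k choose (k div 2))"
    using binomial_maximum by simp
  moreover have "k = 1 \<or> k = 2 \<or> k = 3 \<or> k = 4 \<or> k = 5" using assms by linarith
  then have "real (k choose (k div 2)) \<le> (7/4)^k / (3/2)"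
    by (elim disjE) (simp_all add: choose_two power_divide)
  ultimately show ?thesis by linarith
qed

text \<open>
  The out-neighbourhood \<open>S\<close> of the deleted vertex is a subset of its neighbourhood \<open>N\<close> that meets each of
  the components in a prescribed number of points; the choices in different components are independent.
\<close>

lemma card_traces_le:
  assumes fin: "finite N" "finite \<W>" and N: "N \<subseteq> \<Union>\<W>" and k: "card N \<le> 5"
    and disj: "\<And>W W' x. W \<in> \<W> \<Longrightarrow> W' \<in> \<W> \<Longrightarrow> x \<in> W \<Longrightarrow> x \<in> W' \<Longrightarrow> W = W'"
    and meet: "\<And>W. W \<in> \<W> \<Longrightarrow> W \<inter> N \<noteq> {}"
  shows "real (card {S. S \<subseteq> N \<and> (\<forall>W\<in>\<W>. card (S \<inter> W) = c W)})
    \<le> (7/4)^card N / (3/2)^card \<W>"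
proof -
  let ?S = "{S. S \<subseteq> N \<and> (\<forall>W\<in>\<W>. card (S \<inter> W) = c W)}"
  let ?P = "PiE \<W> (\<lambda>W. {T. T \<subseteq> N \<inter> W \<and> card T = c W})"
  let ?f = "\<lambda>S. restrict (\<lambda>W. S \<inter> W) \<W>"
  have inj: "inj_on ?f ?S"
  proof (rule inj_onI)
    fix S T assume S: "S \<in> ?S" and T: "T \<in> ?S" and eq: "?f S = ?f T"
    have "S \<inter> W = T \<inter> W" if "W \<in> \<W>" for W
      using fun_cong[OF eq, of W] that by simp
    then have "S \<inter> \<Union>\<W> = T \<inter> \<Union>\<W>" by blast
    moreover have "S \<subseteq> \<Union>\<W>" "T \<subseteq> \<Union>\<W>"
      using S T by (auto intro!: subset_trans[OF _ N])
    ultimately show "S = T" by (simp add: Int_absorb2)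
  qed
  have "card ?S = card (?f ` ?S)" by (rule card_image[OF inj, symmetric])
  also have "\<dots> \<le> card ?P"
  proof (rule card_mono)
    show "finite ?P" by (rule finite_PiE) (use fin in auto)
  qed auto
  also have "\<dots> = (\<Prod>W\<in>\<W>. card (N \<inter> W) choose c W)"
    unfolding card_PiE[OF fin(2)] by (intro prod.cong refl n_subsets) (use fin in auto)
  finally have "real (card ?S) \<le> real (\<Prod>W\<in>\<W>. card (N \<inter> W) choose c W)"
    by (rule of_nat_mono)
  also have "\<dots> = (\<Prod>W\<in>\<W>. real (card (N \<inter> W) choose c W))" by (rule of_nat_prod)
  also have "\<dots> \<le> (\<Prod>W\<in>\<W>. (7/4)^card (N \<inter> W) / (3/2))"
  proof (intro prod_mono conjI binomial_le_weight)
    fix W assume "W \<in> \<W>"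
    then show "1 \<le> card (N \<inter> W)"
      using meet[of W] fin by (simp add: Suc_le_eq card_gt_0_iff Int_commute)
    show "card (N \<inter> W) \<le> 5" using k card_mono[of N "N \<inter> W"] fin by auto
  qed auto
  also have "\<dots> = (7/4)^(\<Sum>W\<in>\<W>. card (N \<inter> W)) / (3/2)^card \<W>"
    unfolding power_sum prod_dividef by (simp add: power_divide)
  also have "(\<Sum>W\<in>\<W>. card (N \<inter> W)) = card (\<Union>W\<in>\<W>. N \<inter> W)"
    using fin disj by (intro card_UN_disjoint[symmetric]) blast+
  also have "(\<Union>W\<in>\<W>. N \<inter> W) = N" using N by blast
  finally show ?thesis .
qed

theorem card_orientations_with_out_degrees_le:
  assumes "simple_graph V E"
    and "\<And>W. W \<subseteq> V \<Longrightarrow> W \<noteq> {} \<Longrightarrow> \<exists>v\<in>W. card {e \<in> E. e \<subseteq> W \<and> v \<in> e} \<le> 5"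
  shows "real (card (orientations_with_out_degrees E V \<alpha>))
    \<le> (7/4)^card E * (3/2)^card (graph_components V E) / (3/2)^card V"
  using assms
proof (induction "card V" arbitrary: V E \<alpha>)
  case 0
  then have "V = {}" by (simp add: simple_graph_def)
  moreover have "E = {}" using 0 \<open>V = {}\<close> by (auto simp: simple_graph_def)
  moreover have "orientations_with_out_degrees {} {} \<alpha> = {{}}"
    by (auto simp: orientations_with_out_degrees_def)
  ultimately show ?case by (simp add: graph_components_def)
next
  case (Suc n)
  note G = \<open>simple_graph V E\<close>
  have finV: "finite V" using G by (simp add: simple_graph_def)
  have finE: "finite E" by (rule simple_graph_finite_edges[OF G])
  have "V \<noteq> {}" using Suc(2) by auto
  with Suc.prems(2)[of V] obtain v where v: "v \<in> V" "card {e \<in> E. e \<subseteq> V \<and> v \<in> e} \<le> 5" by auto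
  define N where "N = {w. {v, w} \<in> E}"
  define V0 where "V0 = V - {v}"
  define E0 where "E0 = {e \<in> E. v \<notin> e}"
  define \<W> where "\<W> = {W \<in> graph_components V0 E0. W \<inter> N \<noteq> {}}"
  \<comment> \<open>the number of arrows from \<open>v\<close> into \<open>W\<close> that the prescribed out-degrees force\<close>
  define c where "c W = card (N \<inter> W) + card {e \<in> E. e \<subseteq> W} - (\<Sum>w\<in>W. \<alpha> w)" for W
  define \<S> where "\<S> = {S. S \<subseteq> N \<and> (\<forall>W\<in>\<W>. card (S \<inter> W) = c W)}"
  \<comment> \<open>the out-degrees left in the smaller graph when \<open>S\<close> is the set of out-neighbours of \<open>v\<close>\<close>
  define \<beta> where "\<beta> S w = \<alpha> w - (if w \<in> N - S then 1 else 0)" for S w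
  have N: "N \<subseteq> V0" unfolding N_def V0_def using simple_graph_neighbour(2,3)[OF G] by fast
  have finN: "finite N" using N finV unfolding V0_def by (auto intro: finite_subset)
  have G0: "simple_graph V0 E0"
    using G unfolding simple_graph_def V0_def E0_def by fastforce
  have starE: "{e \<in> E. v \<in> e} = (\<lambda>w. {v, w}) ` N"
  proof (intro equalityI subsetI)
    fix e assume e: "e \<in> {e \<in> E. v \<in> e}"
    then obtain x y where "e = {x, y}" using simple_graph_edgeE[OF G] by blast
    then have "\<exists>w. e = {v, w}" using e by auto
    then show "e \<in> (\<lambda>w. {v, w}) ` N" using e unfolding N_def by auto
  qed (auto simp: N_def)
  have star: "card {e \<in> E. v \<in> e} = card N"
    unfolding starE by (rule card_image) (auto simp: inj_on_def doubleton_eq_iff)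
  have "{e \<in> E. e \<subseteq> V \<and> v \<in> e} = {e \<in> E. v \<in> e}"
    using simple_graph_edge_subset[OF G] by auto
  then have N5: "card N \<le> 5" using v(2) star by simp
  have cardE: "card E = card E0 + card N"
  proof -
    have "E = E0 \<union> {e \<in> E. v \<in> e}" unfolding E0_def by auto
    then have "card E = card (E0 \<union> {e \<in> E. v \<in> e})" by (rule arg_cong)
    also have "\<dots> = card E0 + card {e \<in> E. v \<in> e}"
      using finE by (intro card_Un_disjoint) (auto simp: E0_def)
    finally show ?thesis using star by simp
  qed
  have cardV: "card V = Suc (card V0)" unfolding V0_def using card_Suc_Diff1[OF finV v(1)] by simp
  have IH: "real (card (orientations_with_out_degrees E0 V0 \<alpha>'))
      \<le> (7/4)^card E0 * (3/2)^card (graph_components V0 E0) / (3/2)^card V0" for \<alpha>'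
  proof (rule Suc.hyps(1))
    show "n = card V0" using Suc(2) cardV by simp
    fix W assume W: "W \<subseteq> V0" "W \<noteq> {}"
    then obtain u where u: "u \<in> W" "card {e \<in> E. e \<subseteq> W \<and> u \<in> e} \<le> 5"
      using Suc.prems(2)[of W] unfolding V0_def by blast
    have "card {e \<in> E0. e \<subseteq> W \<and> u \<in> e} \<le> card {e \<in> E. e \<subseteq> W \<and> u \<in> e}"
      by (rule card_mono) (use finE in \<open>auto simp: E0_def\<close>)
    then show "\<exists>u\<in>W. card {e \<in> E0. e \<subseteq> W \<and> u \<in> e} \<le> 5" using u by force
  qed (rule G0)
  have finW: "finite \<W>" unfolding \<W>_def V0_def using finV by (simp add: finite_graph_components)
  have NW: "N \<subseteq> \<Union>\<W>"
  proof
    fix x assume x: "x \<in> N"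
    then obtain W where "W \<in> graph_components V0 E0" "x \<in> W"
      using N Union_graph_components[OF G0] by blast
    then show "x \<in> \<Union>\<W>" using x unfolding \<W>_def by auto
  qed
  have cardS: "real (card \<S>) \<le> (7/4)^card N / (3/2)^card \<W>"
    unfolding \<S>_def
  proof (rule card_traces_le[OF finN finW NW N5])
    fix W W' x assume W: "W \<in> \<W>" "W' \<in> \<W>" and x: "x \<in> W" "x \<in> W'"
    have "W \<in> graph_components V0 E0" "W' \<in> graph_components V0 E0"
      using W unfolding \<W>_def by simp_all
    then show "W = W'" using x by (rule graph_components_disjoint)
  qed (simp add: \<W>_def)
  have finS: "finite \<S>" unfolding \<S>_def using finN by auto
  let ?O = "orientations_with_out_degrees E V \<alpha>"
  let ?Or = "\<lambda>S. orientations_with_out_degrees E0 V0 (\<beta> S)"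
  let ?S = "\<lambda>A. {w. (v, w) \<in> A}"
  let ?Ar = "\<lambda>A. {(x, y) \<in> A. x \<noteq> v \<and> y \<noteq> v}"
  have edge: "{x, y} \<in> E" if "A \<in> ?O" "(x, y) \<in> A" for A x y
    using that unfolding orientations_with_out_degrees_def by auto
  have anti: "(x, y) \<in> A \<longleftrightarrow> (y, x) \<notin> A" if "A \<in> ?O" "{x, y} \<in> E" for A x y
    using that unfolding orientations_with_out_degrees_def by auto
  have into_v: "(w, v) \<in> A \<longleftrightarrow> w \<in> N - ?S A" if A: "A \<in> ?O" for A w
    using edge[OF A, of w v] anti[OF A, of w v] unfolding N_def by (auto simp: insert_commute)
  have recover: "A = ?Ar A \<union> {v} \<times> ?S A \<union> (N - ?S A) \<times> {v}" if A: "A \<in> ?O" for A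
    using into_v[OF A] by auto
  have "inj_on (\<lambda>A. (?S A, ?Ar A)) ?O"
  proof (rule inj_onI)
    fix A B assume A: "A \<in> ?O" and B: "B \<in> ?O" and "(?S A, ?Ar A) = (?S B, ?Ar B)"
    then have eq: "?S A = ?S B" "?Ar A = ?Ar B" by blast+
    have "A = ?Ar A \<union> {v} \<times> ?S A \<union> (N - ?S A) \<times> {v}" by (rule recover[OF A])
    also have "\<dots> = B" unfolding eq by (rule recover[OF B, symmetric])
    finally show "A = B" .
  qed
  then have "card ?O = card ((\<lambda>A. (?S A, ?Ar A)) ` ?O)" by (rule card_image[symmetric])
  also have "\<dots> \<le> card (SIGMA S:\<S>. ?Or S)"
  proof (rule card_mono)
    show "finite (SIGMA S:\<S>. ?Or S)"
      using finS finite_orientations[OF G0] by (rule finite_SigmaI)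
    show "(\<lambda>A. (?S A, ?Ar A)) ` ?O \<subseteq> (SIGMA S:\<S>. ?Or S)"
    proof (rule image_subsetI)
      fix A assume A: "A \<in> ?O"
      have SN: "?S A \<subseteq> N" unfolding N_def using edge[OF A] by auto
      have tr: "card (?S A \<inter> W) = c W" if W: "W \<in> \<W>" for W
      proof -
        have W': "W \<in> graph_components V0 E0" using W unfolding \<W>_def by simp
        have WV: "W \<subseteq> V0" by (rule graph_component_subset[OF G0 W'])
        have "(\<Sum>w\<in>W. \<alpha> w) = card {e \<in> E. e \<subseteq> W} + card {w \<in> W. (w, v) \<in> A}"
        proof (rule sum_out_degree_component[OF G A])
          show "W \<subseteq> V" "v \<notin> W" using WV unfolding V0_def by auto
          show "y \<in> insert v W" if "x \<in> W" "{x, y} \<in> E" for x y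
          proof (cases "y = v")
            case False
            then have "{x, y} \<in> E0" using that WV unfolding E0_def V0_def by auto
            then show ?thesis using graph_component_closed[OF W'] that by auto
          qed simp
        qed
        moreover have "{w \<in> W. (w, v) \<in> A} = (N \<inter> W) - (?S A \<inter> W)" using into_v[OF A] by auto
        then have "card {w \<in> W. (w, v) \<in> A} = card (N \<inter> W) - card (?S A \<inter> W)"
          using SN finN finite_subset[OF SN] by (subst card_Diff_subset[symmetric]) auto
        moreover have "card (?S A \<inter> W) \<le> card (N \<inter> W)" using SN finN by (intro card_mono) auto
        ultimately show ?thesis unfolding c_def by linarith
      qed
      have "?Ar A \<in> ?Or (?S A)"
        unfolding orientations_with_out_degrees_def
      proof (intro CollectI conjI ballI allI impI)
        fix w assume w: "w \<in> V0"
        have "{x. (w, x) \<in> A} = {x. (w, x) \<in> ?Ar A} \<union> (if (w, v) \<in> A then {v} else {})"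
          using w unfolding V0_def by auto
        moreover have "{x. (w, x) \<in> ?Ar A} \<subseteq> V"
          using orientations_subset[OF G A] by auto
        then have "finite {x. (w, x) \<in> ?Ar A}" by (rule finite_subset[OF _ finV])
        ultimately have "out_degree A w = out_degree (?Ar A) w + (if (w, v) \<in> A then 1 else 0)"
          unfolding out_degree_def by auto
        moreover have "out_degree A w = \<alpha> w"
          using A w unfolding orientations_with_out_degrees_def V0_def by auto
        ultimately show "out_degree (?Ar A) w = \<beta> (?S A) w"
          unfolding \<beta>_def using into_v[OF A, of w] by auto
      qed (use edge[OF A] anti[OF A] in \<open>auto simp: E0_def\<close>)
      then show "(?S A, ?Ar A) \<in> (SIGMA S:\<S>. ?Or S)"
        using SN tr unfolding \<S>_def by blast
    qed
  qed
  also have "\<dots> = (\<Sum>S\<in>\<S>. card (?Or S))"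
    using finS finite_orientations[OF G0] by (simp add: card_SigmaI)
  finally have "real (card ?O) \<le> real (\<Sum>S\<in>\<S>. card (?Or S))"
    by (rule of_nat_mono)
  also have "\<dots> = (\<Sum>S\<in>\<S>. real (card (?Or S)))" by (rule of_nat_sum)
  also have "\<dots> \<le> (\<Sum>S\<in>\<S>. (7/4)^card E0 * (3/2)^card (graph_components V0 E0) / (3/2)^card V0)"
    by (intro sum_mono IH)
  also have "\<dots> = real (card \<S>) * ((7/4)^card E0 * (3/2)^card (graph_components V0 E0) / (3/2)^card V0)"
    by simp
  also have "\<dots> \<le> ((7/4)^card N / (3/2)^card \<W>) *
      ((7/4)^card E0 * (3/2)^card (graph_components V0 E0) / (3/2)^card V0)"
    by (intro mult_right_mono cardS) simp
  also have "\<dots> = (7/4)^card E * (3/2)^(card (graph_components V0 E0) + 1) / ((3/2)^card V * (3/2)^card \<W>)"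
    unfolding cardE cardV by (simp add: power_add field_simps)
  also have "\<dots> \<le> (7/4)^card E * (3/2)^(card (graph_components V E) + card \<W>) / ((3/2)^card V * (3/2)^card \<W>)"
  proof (intro divide_right_mono mult_left_mono power_increasing)
    show "card (graph_components V0 E0) + 1 \<le> card (graph_components V E) + card \<W>"
      unfolding \<W>_def V0_def
      by (rule card_graph_components_delete_vertex[OF finV v(1) _ E0_def N_def])
        (use G0 in \<open>simp add: V0_def\<close>)
  qed auto
  also have "\<dots> = (7/4)^card E * (3/2)^card (graph_components V E) / (3/2)^card V"
    by (simp add: power_add)
  finally show ?case .
qed

section \<open>Faces of a plane drawing\<close>

definition drawing ::
  "'v set \<Rightarrow> 'v set set \<Rightarrow> ('v \<Rightarrow> complex) \<Rightarrow> ('v set \<Rightarrow> real \<Rightarrow> complex) \<Rightarrow> complex set" where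
  "drawing V E p \<gamma> = p ` V \<union> (\<Union>e\<in>E. path_image (\<gamma> e))"

lemma drawing_insert: "drawing V (insert e E) p \<gamma> = path_image (\<gamma> e) \<union> drawing V E p \<gamma>"
  by (auto simp: drawing_def)

lemma drawing_mono: "F \<subseteq> E \<Longrightarrow> drawing V F p \<gamma> \<subseteq> drawing V E p \<gamma>"
  by (auto simp: drawing_def)

text \<open>
  The inverse of the arc would embed a nonempty open set of the plane into the line.
\<close>

lemma open_subset_arc_empty:
  fixes g :: "real \<Rightarrow> complex"
  assumes "arc g" "open U" "U \<subseteq> path_image g"
  shows "U = {}"
proof (rule ccontr)
  assume "U \<noteq> {}"
  obtain h where "homeomorphism {0..1} (path_image g) g h"
    using homeomorphism_arc[OF \<open>arc g\<close>] .
  then have "continuous_on U h" "inj_on h U"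
    using assms(3) unfolding homeomorphism_def
    by (auto intro!: inj_on_inverseI[of U g h] elim: continuous_on_subset)
  then have "DIM(complex) \<le> DIM(real)"
    using invariance_of_dimension \<open>open U\<close> \<open>U \<noteq> {}\<close> by blast
  then show False by simp
qed

lemma component_minus_arc:
  fixes S :: "complex set"
  assumes "closed S" "arc g" "C \<in> components (- S)"
  shows "\<exists>C'\<in>components (- (path_image g \<union> S)). C' \<subseteq> C"
proof -
  have "open C" using assms by (auto intro: open_components simp: open_Compl)
  moreover have "C \<noteq> {}" by (rule in_components_nonempty[OF assms(3)])
  ultimately have "\<not> C \<subseteq> path_image g" using open_subset_arc_empty[OF assms(2)] by blast
  then obtain y where y: "y \<in> C" "y \<notin> path_image g" by blast
  let ?C' = "connected_component_set (- (path_image g \<union> S)) y"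
  have yS: "y \<in> - (path_image g \<union> S)" using y in_components_subset[OF assms(3)] by blast
  have "?C' \<subseteq> - S" using connected_component_subset by fastforce
  moreover have "y \<in> ?C'" using yS by simp
  ultimately have "?C' \<subseteq> C"
    using components_maximal[OF assms(3) connected_connected_component] y by blast
  then show ?thesis using componentsI[OF yS] by blast
qed

text \<open>
  The members of \<open>F\<close> and \<open>F'\<close> will be the faces before and after an edge is added; two new faces inside one
  old face make the inequality strict.
\<close>

lemma card_refinement:
  assumes fin: "finite F'" and disj: "\<forall>C\<in>F. \<forall>D\<in>F. C \<inter> D \<noteq> {} \<longrightarrow> C = D"
    and ne: "{} \<notin> F'" and sub: "\<forall>C\<in>F. \<exists>C'\<in>F'. C' \<subseteq> C"
  shows "finite F" "card F \<le> card F'"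
    and "C0 \<in> F \<Longrightarrow> C1 \<in> F' \<Longrightarrow> C2 \<in> F' \<Longrightarrow> C1 \<noteq> C2 \<Longrightarrow> C1 \<subseteq> C0 \<Longrightarrow> C2 \<subseteq> C0 \<Longrightarrow> card F < card F'"
proof -
  obtain g where g: "\<And>C. C \<in> F \<Longrightarrow> g C \<in> F' \<and> g C \<subseteq> C" using sub by metis
  have same: "C = D" if "C \<in> F" "D \<in> F" "g C \<subseteq> D" for C D
  proof -
    have "g C \<subseteq> C" "g C \<noteq> {}" using g[OF that(1)] ne by auto
    then have "C \<inter> D \<noteq> {}" using that(3) by blast
    then show ?thesis using disj that(1,2) by blast
  qed
  have inj: "inj_on g F"
  proof (rule inj_onI)
    fix C D assume "C \<in> F" "D \<in> F" "g C = g D"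
    then show "C = D" using same[of C D] g[of D] by simp
  qed
  have im: "g ` F \<subseteq> F'" using g by blast
  show "finite F" using inj_on_finite[OF inj im fin] .
  show "card F \<le> card F'" using card_inj_on_le[OF inj im fin] .
  assume C: "C0 \<in> F" "C1 \<in> F'" "C2 \<in> F'" "C1 \<noteq> C2" "C1 \<subseteq> C0" "C2 \<subseteq> C0"
  have "\<exists>X\<in>F'. X \<notin> g ` F"
  proof (rule ccontr)
    assume "\<not> ?thesis"
    then have "C1 \<in> g ` F" "C2 \<in> g ` F" using C(2,3) by blast+
    then obtain D1 D2 where D: "D1 \<in> F" "C1 = g D1" "D2 \<in> F" "C2 = g D2" by (elim imageE)
    have "D1 = C0" by (rule same) (use C D in simp_all)
    moreover have "D2 = C0" by (rule same) (use C D in simp_all)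
    ultimately show False using D C(4) by simp
  qed
  then have "g ` F \<subset> F'" using im by blast
  then have "card (g ` F) < card F'" by (rule psubset_card_mono[OF fin])
  then show "card F < card F'" by (simp add: card_image[OF inj])
qed

locale plane_graph =
  fixes V :: "'v set" and E :: "'v set set" and p :: "'v \<Rightarrow> complex"
    and \<gamma> :: "'v set \<Rightarrow> real \<Rightarrow> complex"
  assumes simple: "simple_graph V E" and embedding: "plane_embedding V E p \<gamma>"
begin

lemma finite_verts: "finite V"
  using simple by (simp add: simple_graph_def)

lemma finite_edges: "finite E"
  by (rule simple_graph_finite_edges[OF simple])

lemma inj_point: "inj_on p V"
  using embedding by (simp add: plane_embedding_def)

lemma arc_edge: "e \<in> E \<Longrightarrow> arc (\<gamma> e)"
  using embedding by (simp add: plane_embedding_def)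

lemma arc_ends: "e \<in> E \<Longrightarrow> {pathstart (\<gamma> e), pathfinish (\<gamma> e)} = p ` e"
  using embedding by (simp add: plane_embedding_def)

lemma ends_in_arc: "e \<in> E \<Longrightarrow> p ` e \<subseteq> path_image (\<gamma> e)"
  by (simp add: arc_ends[symmetric] pathstart_in_path_image pathfinish_in_path_image)

lemma arcs_meet:
  "e \<in> E \<Longrightarrow> f \<in> E \<Longrightarrow> e \<noteq> f \<Longrightarrow> path_image (\<gamma> e) \<inter> path_image (\<gamma> f) \<subseteq> p ` (e \<inter> f)"
  using embedding by (simp add: plane_embedding_def)

lemma vertex_on_arc: "e \<in> E \<Longrightarrow> v \<in> V \<Longrightarrow> p v \<in> path_image (\<gamma> e) \<Longrightarrow> v \<in> e"
  using embedding unfolding plane_embedding_def by (elim conjE) blast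

lemma subgraph:
  assumes sub: "W \<subseteq> V" "F \<subseteq> E" and "simple_graph W F"
  shows "plane_graph W F p \<gamma>"
proof
  show "plane_embedding W F p \<gamma>"
    unfolding plane_embedding_def
  proof (intro conjI ballI impI)
    show "inj_on p W" by (rule inj_on_subset[OF inj_point sub(1)])
  next
    fix e assume e: "e \<in> F"
    then have "e \<in> E" using sub(2) by (rule rev_subsetD)
    then show "arc (\<gamma> e)" "{pathstart (\<gamma> e), pathfinish (\<gamma> e)} = p ` e"
      by (rule arc_edge, rule arc_ends)
    show "v \<in> e" if "v \<in> W" "p v \<in> path_image (\<gamma> e)" for v
      using vertex_on_arc[OF \<open>e \<in> E\<close>] that sub(1) by blast
    show "path_image (\<gamma> e) \<inter> path_image (\<gamma> f) \<subseteq> p ` (e \<inter> f)" if "f \<in> F" "e \<noteq> f" for f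
      by (rule arcs_meet) (use e that sub(2) in auto)
  qed
qed fact

lemma spanning_subgraph: "F \<subseteq> E \<Longrightarrow> plane_graph V F p \<gamma>"
  using subgraph[of V F] simple_graph_subset[OF simple] by simp

lemma arc_meets_rest:
  assumes "e \<in> E"
  shows "path_image (\<gamma> e) \<inter> drawing V (E - {e}) p \<gamma> \<subseteq> p ` e"
proof
  fix x assume x: "x \<in> path_image (\<gamma> e) \<inter> drawing V (E - {e}) p \<gamma>"
  then consider v where "v \<in> V" "x = p v" | f where "f \<in> E - {e}" "x \<in> path_image (\<gamma> f)"
    by (auto simp: drawing_def)
  then show "x \<in> p ` e"
  proof cases
    case 1
    then show ?thesis using x vertex_on_arc[OF assms] by blast
  next
    case 2
    then show ?thesis using x arcs_meet[OF assms, of f] by blast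
  qed
qed

lemma compact_drawing: "compact (drawing V E p \<gamma>)"
  unfolding drawing_def
proof (rule compact_Un)
  show "compact (p ` V)" using finite_verts by (simp add: finite_imp_compact)
  show "compact (\<Union>e\<in>E. path_image (\<gamma> e))"
    by (rule compact_UN[OF finite_edges]) (simp add: arc_edge compact_arc_image)
qed

lemma closed_drawing: "closed (drawing V E p \<gamma>)"
  by (rule compact_imp_closed[OF compact_drawing])

definition open_edge :: "'v set \<Rightarrow> complex set" where
  "open_edge e = path_image (\<gamma> e) - p ` e"

lemma open_edge_nonempty: "e \<in> E \<Longrightarrow> open_edge e \<noteq> {}"
  unfolding open_edge_def arc_ends[symmetric]
  by (intro nonempty_simple_path_endless arc_imp_simple_path arc_edge)

lemma connected_open_edge: "e \<in> E \<Longrightarrow> connected (open_edge e)"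
  unfolding open_edge_def arc_ends[symmetric]
  by (intro connected_simple_path_endless arc_imp_simple_path arc_edge)

lemma open_edge_disjoint: "e \<in> E \<Longrightarrow> open_edge e \<inter> drawing V (E - {e}) p \<gamma> = {}"
  using arc_meets_rest[of e] unfolding open_edge_def by blast

lemma drawing_split: "e \<in> E \<Longrightarrow> drawing V E p \<gamma> = path_image (\<gamma> e) \<union> drawing V (E - {e}) p \<gamma>"
  using drawing_insert[of V e "E - {e}" p \<gamma>] by (simp add: insert_absorb)

lemma linked_path_component:
  assumes "(a, b) \<in> linked E" "a \<in> V"
  shows "path_component (drawing V E p \<gamma>) (p a) (p b)"
  using assms(1) unfolding linked_def
proof (induction rule: rtrancl_induct)
  case base
  show ?case by (rule path_component_refl) (use assms(2) in \<open>simp add: drawing_def\<close>)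
next
  case (step y z)
  have yz: "{y, z} \<in> E" using step(2) by simp
  have "path_component (path_image (\<gamma> {y, z})) (p y) (p z)"
    using path_connected_path_image[of "\<gamma> {y, z}"] arc_imp_path[OF arc_edge[OF yz]] ends_in_arc[OF yz]
    unfolding path_connected_component by auto
  moreover have "path_image (\<gamma> {y, z}) \<subseteq> drawing V E p \<gamma>" using yz unfolding drawing_def by blast
  ultimately have "path_component (drawing V E p \<gamma>) (p y) (p z)" by (rule path_component_of_subset[rotated])
  then show ?case using step.IH path_component_trans by blast
qed

text \<open>
  A path in the rest of the drawing between the ends of \<open>e\<close> contains an arc, which closes up the edge to
  a Jordan curve.  The last conclusion holds because the curve meets the rest of the drawing exactly in this
  arc; it is the connectedness that Janiszewski's theorem asks for.
\<close>

lemma edge_on_closed_curve: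
  assumes e: "e \<in> E" "e = {a, b}" and ab: "(a, b) \<in> linked (E - {e})"
  obtains c where "simple_path c" "pathfinish c = pathstart c"
    "path_image (\<gamma> e) \<subseteq> path_image c" "path_image c \<subseteq> drawing V E p \<gamma>"
    "connected (path_image c \<inter> drawing V (E - {e}) p \<gamma>)"
proof -
  interpret rest: plane_graph V "E - {e}" p \<gamma> by (rule spanning_subgraph) auto
  let ?D = "drawing V (E - {e}) p \<gamma>"
  have V: "a \<in> V" "b \<in> V" "a \<noteq> b" using simple_graph_neighbour[OF simple, of a b] e by auto
  have ends: "{pathstart (\<gamma> e), pathfinish (\<gamma> e)} = {p a, p b}" using arc_ends[OF e(1)] e(2) by simp
  have pab: "p a \<noteq> p b" using inj_onD[OF inj_point] V by blast
  have "path_component ?D (p a) (p b)" by (rule rest.linked_path_component[OF ab V(1)])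
  then have "path_component ?D (pathfinish (\<gamma> e)) (pathstart (\<gamma> e))"
    using ends path_component_sym by (fastforce simp: doubleton_eq_iff)
  then obtain g where g: "path g" "path_image g \<subseteq> ?D"
    "pathstart g = pathfinish (\<gamma> e)" "pathfinish g = pathstart (\<gamma> e)"
    unfolding path_component_def by blast
  have "pathfinish (\<gamma> e) \<noteq> pathstart (\<gamma> e)" using ends pab by (auto simp: doubleton_eq_iff)
  then obtain q where q: "arc q" "path_image q \<subseteq> path_image g"
    "pathstart q = pathfinish (\<gamma> e)" "pathfinish q = pathstart (\<gamma> e)"
    using path_contains_arc[OF g(1,3,4)] by blast
  have qD: "path_image q \<subseteq> ?D" using q(2) g(2) by blast
  have meet: "path_image (\<gamma> e) \<inter> ?D \<subseteq> {pathstart (\<gamma> e), pathfinish (\<gamma> e)}"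
    using arc_meets_rest[OF e(1)] arc_ends[OF e(1)] by blast
  let ?c = "\<gamma> e +++ q"
  have im: "path_image ?c = path_image (\<gamma> e) \<union> path_image q" by (rule path_image_join) (use q in simp)
  show thesis
  proof (rule that)
    show "simple_path ?c"
    proof (rule simple_path_join_loop)
      show "path_image (\<gamma> e) \<inter> path_image q \<subseteq> {pathstart (\<gamma> e), pathstart q}"
        using meet qD q(3) by auto
    qed (use arc_edge[OF e(1)] q in auto)
    show "pathfinish ?c = pathstart ?c" using q by simp
    show "path_image (\<gamma> e) \<subseteq> path_image ?c" using im by simp
    show "path_image ?c \<subseteq> drawing V E p \<gamma>" unfolding im drawing_split[OF e(1)] using qD by blast
    have "{pathstart (\<gamma> e), pathfinish (\<gamma> e)} \<subseteq> path_image q"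
      using pathstart_in_path_image[of q] pathfinish_in_path_image[of q] q by simp
    then have "path_image ?c \<inter> ?D = path_image q" unfolding im using qD meet by blast
    then show "connected (path_image ?c \<inter> ?D)" using connected_arc_image[OF q(1)] by simp
  qed
qed

definition faces :: "complex set set" where
  "faces = components (- drawing V E p \<gamma>)"

text \<open>
  The vertices are excluded because arbitrarily many faces may meet at a vertex.
\<close>

definition faces_along :: "'v set \<Rightarrow> complex set set" where
  "faces_along e = {C \<in> faces. frontier C \<inter> open_edge e \<noteq> {}}"

text \<open>
  Close up \<open>e\<close> to a Jordan curve \<open>J\<close>.  All faces along \<open>e\<close> lie in one face \<open>D0\<close> of the drawing without \<open>e\<close>.
  Two points of \<open>D0\<close> on the same side of \<open>J\<close> are separated neither by \<open>J\<close> nor by the drawing without \<open>e\<close>,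
  hence not by the union of both, by Janiszewski's theorem.  So each side of \<open>J\<close> has at most one face
  along \<open>e\<close>.
\<close>

lemma faces_along_le_2:
  assumes e: "e \<in> E" "e = {a, b}" and ab: "(a, b) \<in> linked (E - {e})"
  shows "finite (faces_along e)" "card (faces_along e) \<le> 2"
proof -
  interpret rest: plane_graph V "E - {e}" p \<gamma> by (rule spanning_subgraph) auto
  let ?D = "drawing V (E - {e}) p \<gamma>"
  obtain c where c: "simple_path c" "pathfinish c = pathstart c"
    "path_image (\<gamma> e) \<subseteq> path_image c" "path_image c \<subseteq> drawing V E p \<gamma>"
    "connected (path_image c \<inter> ?D)"
    using edge_on_closed_curve[OF assms] .
  let ?J = "path_image c"
  note J = Jordan_inside_outside[OF c(1,2)]
  have DE: "?J \<union> ?D = drawing V E p \<gamma>"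
    using c(3,4) drawing_split[OF e(1)] by blast
  have "open_edge e \<subseteq> - ?D" using open_edge_disjoint[OF e(1)] by blast
  then obtain D0 where D0: "D0 \<in> components (- ?D)" "open_edge e \<subseteq> D0"
    using exists_component_superset[OF _ _ connected_open_edge[OF e(1)]] open_edge_nonempty[OF e(1)]
    by (metis subset_empty)
  have in_D0: "C \<subseteq> D0" if C: "C \<in> faces_along e" for C
  proof -
    obtain x where x: "x \<in> frontier C" "x \<in> open_edge e" using C unfolding faces_along_def by blast
    have comp: "C \<in> components (- drawing V E p \<gamma>)" using C by (simp add: faces_along_def faces_def)
    have "open D0" by (rule open_components[OF _ D0(1)]) (simp add: rest.closed_drawing open_Compl)
    moreover have "x \<in> closure C" "x \<in> D0" using x D0(2) by (auto simp: frontier_def)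
    ultimately have "D0 \<inter> C \<noteq> {}" using open_Int_closure_eq_empty[of D0 C] by blast
    moreover have "C \<subseteq> - ?D"
      using in_components_subset[OF comp] DE by blast
    ultimately show ?thesis
      using components_maximal[OF D0(1) in_components_connected[OF comp]] by blast
  qed
  have one_side: "C \<subseteq> inside ?J \<or> C \<subseteq> outside ?J" if C: "C \<in> faces" for C
  proof -
    have "C \<subseteq> - ?J" using C in_components_subset[of C] c(4) unfolding faces_def by blast
    then have sub: "C \<subseteq> inside ?J \<union> outside ?J" and "C \<inter> ?J = {}" using J by auto
    then have "C \<inter> frontier (inside ?J) = {}" using J by simp
    moreover have "connected C" using C in_components_connected unfolding faces_def by blast
    ultimately have "C \<inter> inside ?J = {} \<or> C - inside ?J = {}" using connected_Int_frontier by blast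
    then show ?thesis using sub by blast
  qed
  have unique: "C = C'"
    if C: "C \<in> faces_along e" "C' \<in> faces_along e" and R: "C \<subseteq> R" "C' \<subseteq> R" "connected R" "R \<subseteq> - ?J"
    for C C' R
  proof -
    have comp: "C \<in> components (- drawing V E p \<gamma>)" "C' \<in> components (- drawing V E p \<gamma>)"
      using C by (simp_all add: faces_along_def faces_def)
    obtain x y where xy: "x \<in> C" "y \<in> C'" using comp in_components_nonempty by blast
    have "connected_component (- ?J) x y"
      unfolding connected_component_def using R xy by blast
    moreover have "connected_component (- ?D) x y"
      unfolding connected_component_def
      using in_components_connected[OF D0(1)] in_components_subset[OF D0(1)] in_D0 C xy by blast
    ultimately have "connected_component (- (?J \<union> ?D)) x y"
      by (intro Janiszewski c(5) rest.closed_drawing compact_simple_path_image c(1))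
    then have "connected_component (- drawing V E p \<gamma>) x y" by (simp only: DE)
    then obtain T where T: "connected T" "T \<subseteq> - drawing V E p \<gamma>" "x \<in> T" "y \<in> T"
      unfolding connected_component_def by blast
    show ?thesis by (rule joinable_components_eq[of T "- drawing V E p \<gamma>"]) (use T comp xy in auto)
  qed
  let ?I = "{C \<in> faces_along e. C \<subseteq> inside ?J}" and ?O = "{C \<in> faces_along e. C \<subseteq> outside ?J}"
  have single: "finite X \<and> card X \<le> 1" if "\<And>C C'. C \<in> X \<Longrightarrow> C' \<in> X \<Longrightarrow> C = C'" for X :: "complex set set"
  proof -
    have "X = {} \<or> (\<exists>C. X = {C})" using that by blast
    then show ?thesis by auto
  qed
  have IO: "faces_along e = ?I \<union> ?O" using one_side unfolding faces_along_def by blast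
  have I: "finite ?I \<and> card ?I \<le> 1"
  proof (rule single)
    fix C C' assume C: "C \<in> ?I" "C' \<in> ?I"
    show "C = C'"
    proof (rule unique)
      show "connected (inside ?J)" using J by simp
      show "inside ?J \<subseteq> - ?J" using inside_no_overlap[of ?J] by blast
    qed (use C in auto)
  qed
  have O: "finite ?O \<and> card ?O \<le> 1"
  proof (rule single)
    fix C C' assume C: "C \<in> ?O" "C' \<in> ?O"
    show "C = C'"
    proof (rule unique)
      show "connected (outside ?J)" using J by simp
      show "outside ?J \<subseteq> - ?J" using outside_no_overlap[of ?J] by blast
    qed (use C in auto)
  qed
  have "finite (?I \<union> ?O)" using I O by simp
  then show "finite (faces_along e)" by (simp only: IO[symmetric])
  have "card (faces_along e) = card (?I \<union> ?O)" by (rule arg_cong[OF IO])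
  also have "\<dots> \<le> card ?I + card ?O" by (rule card_Un_le)
  also have "\<dots> \<le> 2" using I O by linarith
  finally show "card (faces_along e) \<le> 2" .
qed

text \<open>
  One arc does not separate the plane, and two arcs with at most one common point do not either, by
  Janiszewski's theorem.  Simplicity of the graph excludes a second common end.
\<close>

lemma connected_complement_le_2_edges:
  assumes "card E \<le> 2"
  shows "connected (- drawing V E p \<gamma>)"
proof -
  let ?A = "\<Union>e\<in>E. path_image (\<gamma> e)"
  have arc_compl: "connected (- path_image (\<gamma> e))" if "e \<in> E" for e
    using connected_arc_complement[OF arc_edge[OF that]] by simp
  have "card E = 0 \<or> card E = 1 \<or> card E = 2" using assms by linarith
  then have "connected (- ?A)"
  proof (elim disjE)
    assume "card E = 0"
    then have "E = {}" using finite_edges by simp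
    then show ?thesis by (simp add: connected_UNIV)
  next
    assume "card E = 1"
    then obtain e where "E = {e}" by (rule card_1_singletonE)
    then show ?thesis using arc_compl by simp
  next
    assume "card E = 2"
    then obtain e f where ef: "E = {e, f}" "e \<noteq> f" by (auto simp: card_2_iff)
    have "e \<in> E" "f \<in> E" using ef by auto
    obtain u v x y where uv: "e = {u, v}" "f = {x, y}"
      using simple_graph_edgeE[OF simple \<open>e \<in> E\<close>] simple_graph_edgeE[OF simple \<open>f \<in> E\<close>] by metis
    then have "\<exists>w. e \<inter> f \<subseteq> {w}" using ef(2) by fastforce
    then obtain w where "e \<inter> f \<subseteq> {w}" by blast
    then have "path_image (\<gamma> e) \<inter> path_image (\<gamma> f) \<subseteq> {p w}"
      using arcs_meet[OF \<open>e \<in> E\<close> \<open>f \<in> E\<close> ef(2)] by blast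
    then have "path_image (\<gamma> e) \<inter> path_image (\<gamma> f) = {} \<or> path_image (\<gamma> e) \<inter> path_image (\<gamma> f) = {p w}"
      by blast
    then have conn: "connected (path_image (\<gamma> e) \<inter> path_image (\<gamma> f))" by auto
    have "connected (- (path_image (\<gamma> e) \<union> path_image (\<gamma> f)))"
      using arc_edge arc_compl \<open>e \<in> E\<close> \<open>f \<in> E\<close>
      by (intro Janiszewski_connected conn) (auto simp: compact_arc_image closed_arc_image)
    then show ?thesis using ef(1) by simp
  qed
  moreover have "compact ?A"
    by (rule compact_UN[OF finite_edges]) (simp add: arc_edge compact_arc_image)
  then have "open (- ?A)" by (rule open_Compl[OF compact_imp_closed])
  ultimately have "connected (- ?A - p ` V)"
    using finite_verts by (intro connected_open_delete_finite) auto
  moreover have "- ?A - p ` V = - drawing V E p \<gamma>" by (auto simp: drawing_def)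
  ultimately show ?thesis by simp
qed

text \<open>
  The frontier of a face is drawn by the vertices and the edges that the face touches.  If these edges
  were at most two, their drawing would have a connected complement, and the face would be all of it; then
  the other edges would have no place.
\<close>

lemma face_has_3_edges:
  assumes "3 \<le> card E" "C \<in> faces"
  shows "3 \<le> card {e \<in> E. frontier C \<inter> open_edge e \<noteq> {}}"
proof (rule ccontr)
  let ?F = "{e \<in> E. frontier C \<inter> open_edge e \<noteq> {}}"
  assume "\<not> 3 \<le> card ?F"
  then have F2: "card ?F \<le> 2" by simp
  interpret bd: plane_graph V ?F p \<gamma> by (rule spanning_subgraph) auto
  have C: "C \<in> components (- drawing V E p \<gamma>)" using assms(2) by (simp add: faces_def)
  let ?U = "- drawing V ?F p \<gamma>"
  have CU: "C \<subseteq> ?U"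
    using in_components_subset[OF C] drawing_mono[of ?F E V p \<gamma>] by blast
  have front: "frontier C \<subseteq> drawing V E p \<gamma>"
    by (rule frontier_of_components_closed_complement[OF closed_drawing C])
  have "frontier C \<subseteq> drawing V ?F p \<gamma>"
  proof
    fix x assume x: "x \<in> frontier C"
    then consider "x \<in> p ` V" | e where "e \<in> E" "x \<in> path_image (\<gamma> e)"
      using front unfolding drawing_def by blast
    then show "x \<in> drawing V ?F p \<gamma>"
    proof cases
      case 1
      then show ?thesis by (simp add: drawing_def)
    next
      case (2 e)
      have "p ` e \<subseteq> p ` V" using simple_graph_edge_subset[OF simple 2(1)] by (rule image_mono)
      then show ?thesis using x 2 unfolding drawing_def open_edge_def by blast
    qed
  qed
  then have "?U \<inter> frontier C = {}" by blast
  moreover have "?U \<inter> C \<noteq> {}" using CU in_components_nonempty[OF C] by blast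
  ultimately have "?U \<subseteq> C"
    using connected_Int_frontier[OF bd.connected_complement_le_2_edges[OF F2]] by blast
  then have DF: "drawing V E p \<gamma> \<subseteq> drawing V ?F p \<gamma>"
    using in_components_subset[OF C] by blast
  have "?F \<noteq> E" using F2 assms(1) by auto
  then obtain e where e: "e \<in> E" "e \<notin> ?F" by blast
  have "open_edge e \<subseteq> drawing V E p \<gamma>" using e(1) unfolding open_edge_def drawing_def by blast
  also have "\<dots> \<subseteq> drawing V (E - {e}) p \<gamma>"
    using DF drawing_mono[of ?F "E - {e}" V p \<gamma>] e by blast
  finally show False using open_edge_disjoint[OF e(1)] open_edge_nonempty[OF e(1)] by blast
qed

lemma faces_disjoint: "C \<in> faces \<Longrightarrow> D \<in> faces \<Longrightarrow> C \<inter> D \<noteq> {} \<Longrightarrow> C = D"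
  unfolding faces_def using components_eq by blast

lemma empty_not_face: "{} \<notin> faces"
  unfolding faces_def using in_components_nonempty by blast

end

text \<open>
  Adding an arc never destroys a face, as an arc has empty interior.  If it closes a curve \<open>J\<close>, then the
  face around an interior point \<open>x\<close> of the arc is split, since every neighbourhood of \<open>x\<close> contains points
  inside and outside of \<open>J\<close>.
\<close>

lemma faces_delete_edge:
  assumes "plane_graph V E p \<gamma>" and e: "e \<in> E" "e = {a, b}"
    and fin: "finite (plane_graph.faces V E p \<gamma>)"
  shows "finite (plane_graph.faces V (E - {e}) p \<gamma>)"
    and "card (plane_graph.faces V (E - {e}) p \<gamma>) \<le> card (plane_graph.faces V E p \<gamma>)"
    and "(a, b) \<in> linked (E - {e}) \<Longrightarrow>
      card (plane_graph.faces V (E - {e}) p \<gamma>) < card (plane_graph.faces V E p \<gamma>)"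
proof -
  interpret plane_graph V E p \<gamma> by fact
  interpret rest: plane_graph V "E - {e}" p \<gamma> by (rule spanning_subgraph) auto
  let ?D = "drawing V (E - {e}) p \<gamma>"
  have ref: "\<forall>C\<in>rest.faces. \<exists>C'\<in>faces. C' \<subseteq> C"
    using component_minus_arc[OF rest.closed_drawing arc_edge[OF e(1)]]
    unfolding faces_def rest.faces_def drawing_split[OF e(1)] by blast
  have disj: "\<forall>C\<in>rest.faces. \<forall>D\<in>rest.faces. C \<inter> D \<noteq> {} \<longrightarrow> C = D"
    using rest.faces_disjoint by blast
  note card = card_refinement[OF fin disj empty_not_face ref]
  show "finite rest.faces" "card rest.faces \<le> card faces" by (rule card)+
  assume "(a, b) \<in> linked (E - {e})"
  then obtain c where c: "simple_path c" "pathfinish c = pathstart c"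
    "path_image (\<gamma> e) \<subseteq> path_image c" "path_image c \<subseteq> drawing V E p \<gamma>"
    using edge_on_closed_curve[OF e] by metis
  let ?J = "path_image c"
  note J = Jordan_inside_outside[OF c(1,2)]
  obtain x where x: "x \<in> open_edge e" using open_edge_nonempty[OF e(1)] by blast
  then have "x \<in> - ?D" using open_edge_disjoint[OF e(1)] by blast
  moreover have "open (- ?D)" by (simp add: rest.closed_drawing open_Compl)
  ultimately obtain r where r: "0 < r" "ball x r \<subseteq> - ?D" using open_contains_ball by blast
  have xJ: "x \<in> ?J" using x c(3) unfolding open_edge_def by blast
  have near: "\<exists>y\<in>ball x r. y \<in> R" if "frontier R = ?J" for R
  proof -
    have "x \<in> closure R" using xJ that by (auto simp: frontier_def)
    then obtain y where "y \<in> R" "dist y x < r" using r(1) unfolding closure_approachable by blast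
    then show ?thesis by (auto simp: dist_commute)
  qed
  obtain y where y: "y \<in> ball x r" "y \<in> inside ?J" using near[of "inside ?J"] J by blast
  obtain z where z: "z \<in> ball x r" "z \<in> outside ?J" using near[of "outside ?J"] J by blast
  have off: "w \<in> - drawing V E p \<gamma>" if "w \<in> ball x r" "w \<notin> ?J" for w
    using that r(2) c(3) unfolding drawing_split[OF e(1)] by blast
  have yJ: "y \<notin> ?J" and zJ: "z \<notin> ?J" using J y z by blast+
  let ?C = "connected_component_set (- drawing V E p \<gamma>)"
  have Cy: "?C y \<in> faces" "?C z \<in> faces"
    unfolding faces_def by (intro componentsI off y z yJ zJ)+
  have yz: "y \<in> ?C y" "z \<in> ?C z" using off y z yJ zJ by auto
  have Cyz: "?C y \<noteq> ?C z"
  proof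
    assume eq: "?C y = ?C z"
    have "?C y \<inter> inside ?J \<noteq> {}" using yz y by blast
    moreover have "z \<notin> inside ?J" using z J by blast
    then have "?C y - inside ?J \<noteq> {}" using yz(2) eq by blast
    ultimately have "?C y \<inter> frontier (inside ?J) \<noteq> {}"
      by (intro connected_Int_frontier connected_connected_component)
    moreover have "frontier (inside ?J) = ?J" using J by simp
    moreover have "?C y \<subseteq> - ?J"
      using c(4) connected_component_subset[of "- drawing V E p \<gamma>" y] by blast
    ultimately show False by blast
  qed
  obtain C0 where C0: "C0 \<in> rest.faces" "ball x r \<subseteq> C0"
    using exists_component_superset[OF r(2) _ connected_ball] r unfolding rest.faces_def by fastforce
  have sub: "?C w \<subseteq> C0" if "w \<in> ball x r" "w \<in> ?C w" for w
  proof (rule components_maximal[of C0 "- ?D"])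
    show "C0 \<in> components (- ?D)" using C0(1) by (simp add: rest.faces_def)
    show "?C w \<subseteq> - ?D"
      using connected_component_subset[of "- drawing V E p \<gamma>" w] drawing_split[OF e(1)] by blast
    show "C0 \<inter> ?C w \<noteq> {}" using that C0(2) by blast
  qed (rule connected_connected_component)
  show "card rest.faces < card faces"
    by (rule card(3)[OF C0(1) Cy Cyz sub[OF y(1) yz(1)] sub[OF z(1) yz(2)]])
qed

section \<open>The number of edges of a plane graph\<close>

text \<open>
  When the edges are added one by one, each edge adds a face or joins two components.
\<close>

lemma Euler_lower_bound:
  assumes "plane_graph V E p \<gamma>" "finite (plane_graph.faces V E p \<gamma>)"
  shows "1 + card E + card (graph_components V E) \<le> card (plane_graph.faces V E p \<gamma>) + card V"
  using assms
proof (induction "card E" arbitrary: E)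
  case 0
  interpret plane_graph V E p \<gamma> by fact
  have "E = {}" using 0(1) finite_edges by simp
  have "connected (- drawing V E p \<gamma>)" by (rule connected_complement_le_2_edges) (use 0 in simp)
  moreover have "- drawing V E p \<gamma> \<noteq> {}"
    using compact_drawing not_compact_UNIV[where ?'a = complex] by (metis Compl_empty_eq double_complement)
  ultimately have "faces = {- drawing V E p \<gamma>}"
    unfolding faces_def by (simp add: components_eq_sing_iff)
  moreover have "card (graph_components V E) \<le> card V"
    unfolding graph_components_def quotient_def using finite_verts
    by (simp add: UNION_singleton_eq_range card_image_le)
  ultimately show ?case using \<open>E = {}\<close> by simp
next
  case (Suc m)
  interpret plane_graph V E p \<gamma> by fact
  have "E \<noteq> {}" using Suc(2) by auto
  then obtain e where e: "e \<in> E" by blast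
  then obtain a b where ab: "a \<in> V" "b \<in> V" "e = {a, b}" using simple_graph_edgeE[OF simple] by metis
  note del = faces_delete_edge[OF Suc.prems(1) e ab(3) Suc.prems(2)]
  have card: "card E = Suc (card (E - {e}))" using card_Suc_Diff1[OF finite_edges e] by simp
  have "1 + card (E - {e}) + card (graph_components V (E - {e}))
      \<le> card (plane_graph.faces V (E - {e}) p \<gamma>) + card V"
    by (rule Suc.hyps(1)) (use Suc(2) card del(1) spanning_subgraph in auto)
  moreover have "card (graph_components V E) \<le> card (graph_components V (E - {e}))"
    by (rule card_graph_components_mono[OF finite_verts]) auto
  moreover have "card (graph_components V E) < card (graph_components V (E - {e}))"
    if "(a, b) \<notin> linked (E - {e})"
    by (rule card_graph_components_join[OF finite_verts ab(1,2) that]) (use e ab in auto)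
  ultimately show ?case using del(2,3) card by linarith
qed

text \<open>
  Putting back a bridge raises \<open>3 (n - \<kappa>)\<close> by 3 and the number of edges by 1 only.  If there are no bridges,
  then \<open>3 F \<le> 2 m\<close> for the number \<open>F\<close> of faces, by counting the pairs of a face and an edge along
  it, and Euler's inequality gives the claim.
\<close>

theorem plane_graph_card_edges_le:
  assumes "plane_graph V E p \<gamma>"
  shows "card E + 3 * card (graph_components V E) \<le> 3 * card V"
  using assms
proof (induction "card E" arbitrary: E rule: less_induct)
  case less
  interpret plane_graph V E p \<gamma> by fact
  consider (bridge) e a b where "e \<in> E" "e = {a, b}" "a \<in> V" "b \<in> V" "(a, b) \<notin> linked (E - {e})"
    | (few) "card E \<le> 2"
    | (cycles) "3 \<le> card E" "\<And>e a b. e \<in> E \<Longrightarrow> e = {a, b} \<Longrightarrow> (a, b) \<in> linked (E - {e})"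
    using simple_graph_neighbour[OF simple] by (metis not_less_eq_eq numeral_2_eq_2 numeral_3_eq_3)
  then show ?case
  proof cases
    case bridge
    have card: "card E = Suc (card (E - {e}))" using card_Suc_Diff1[OF finite_edges bridge(1)] by simp
    have "card (E - {e}) + 3 * card (graph_components V (E - {e})) \<le> 3 * card V"
      by (rule less.hyps) (use card spanning_subgraph in auto)
    moreover have "card (graph_components V E) < card (graph_components V (E - {e}))"
      by (rule card_graph_components_join[OF finite_verts bridge(3-5)]) (use bridge in auto)
    ultimately show ?thesis using card by linarith
  next
    case few
    have "\<And>C D. C \<in> faces \<Longrightarrow> D \<in> faces \<Longrightarrow> C = D"
      using connected_complement_le_2_edges[OF few] unfolding faces_def
      by (auto simp: connected_eq_connected_components_eq)
    then have "faces = {} \<or> (\<exists>C. faces = {C})" by blast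
    then have "finite faces" "card faces \<le> 1" by auto
    then show ?thesis using Euler_lower_bound[OF less.prems] by linarith
  next
    case cycles
    have two: "finite (faces_along e)" "card (faces_along e) \<le> 2" if "e \<in> E" for e
      using simple_graph_edgeE[OF simple that] faces_along_le_2[OF that] cycles(2)[OF that] by metis+
    have "faces \<subseteq> (\<Union>e\<in>E. faces_along e)"
    proof
      fix C assume C: "C \<in> faces"
      have "{e \<in> E. frontier C \<inter> open_edge e \<noteq> {}} \<noteq> {}"
        using face_has_3_edges[OF cycles(1) C] by (metis card.empty not_numeral_le_zero)
      then show "C \<in> (\<Union>e\<in>E. faces_along e)" using C unfolding faces_along_def by blast
    qed
    then have fin: "finite faces" using finite_edges two(1) finite_subset by blast
    have "3 * card faces = (\<Sum>C\<in>faces. 3)" by simp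
    also have "\<dots> \<le> (\<Sum>C\<in>faces. card {e \<in> E. frontier C \<inter> open_edge e \<noteq> {}})"
      by (intro sum_mono face_has_3_edges cycles(1))
    also have "\<dots> = (\<Sum>e\<in>E. card (faces_along e))"
      using fin finite_edges unfolding faces_along_def by (intro sum_multicount_gen) auto
    also have "\<dots> \<le> (\<Sum>e\<in>E. 2)" by (intro sum_mono two(2))
    finally have "3 * card faces \<le> 2 * card E" by simp
    then show ?thesis using Euler_lower_bound[OF less.prems fin] by linarith
  qed
qed

section \<open>The upper bound\<close>

lemma sum_degrees:
  assumes "simple_graph V E"
  shows "(\<Sum>v\<in>V. card {e \<in> E. v \<in> e}) = 2 * card E"
proof (rule sum_multicount)
  show "finite V" using assms by (simp add: simple_graph_def)
  show "finite E" by (rule simple_graph_finite_edges[OF assms])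
  show "\<forall>e\<in>E. card {v \<in> V. v \<in> e} = 2"
  proof
    fix e assume "e \<in> E"
    then obtain u v where "u \<in> V" "v \<in> V" "u \<noteq> v" "e = {u, v}" by (rule simple_graph_edgeE[OF assms])
    moreover from this have "{w \<in> V. w \<in> e} = {u, v}" by auto
    ultimately show "card {w \<in> V. w \<in> e} = 2" by simp
  qed
qed

lemma graph_components_nonempty:
  assumes "finite V" "V \<noteq> {}"
  shows "0 < card (graph_components V E)"
proof -
  have "graph_components V E \<noteq> {}" using assms(2) by (simp add: graph_components_def quotient_is_empty)
  then show ?thesis using finite_graph_components[OF assms(1)] by (simp add: card_gt_0_iff)
qed

text \<open>
  Otherwise the edge bound for the subgraph induced by \<open>W\<close> would contradict the handshaking lemma.
\<close>

lemma (in plane_graph) low_degree_vertex: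
  assumes W: "W \<subseteq> V" "W \<noteq> {}"
  shows "\<exists>v\<in>W. card {e \<in> E. e \<subseteq> W \<and> v \<in> e} \<le> 5"
proof (rule ccontr)
  let ?F = "{e \<in> E. e \<subseteq> W}"
  assume "\<not> ?thesis"
  then have high: "6 \<le> card {e \<in> ?F. v \<in> e}" if "v \<in> W" for v
    using that by (force simp: not_le)
  have finW: "finite W" using W(1) finite_verts by (rule finite_subset)
  have G: "simple_graph W ?F"
    unfolding simple_graph_def
  proof (intro conjI ballI)
    fix e assume "e \<in> ?F"
    then have "e \<in> E" "e \<subseteq> W" by auto
    then obtain u v where "u \<noteq> v" "e = {u, v}" using simple_graph_edgeE[OF simple] by metis
    then show "\<exists>u\<in>W. \<exists>v\<in>W. u \<noteq> v \<and> e = {u, v}" using \<open>e \<subseteq> W\<close> by blast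
  qed (rule finW)
  have "plane_graph W ?F p \<gamma>" by (rule subgraph[OF W(1) _ G]) auto
  then have "card ?F + 3 * card (graph_components W ?F) \<le> 3 * card W" by (rule plane_graph_card_edges_le)
  then have "card ?F < 3 * card W" using graph_components_nonempty[OF finW W(2), of ?F] by linarith
  moreover have "card W * 6 \<le> (\<Sum>v\<in>W. card {e \<in> ?F. v \<in> e})"
    using sum_mono[of W "\<lambda>_. 6" "\<lambda>v. card {e \<in> ?F. v \<in> e}"] high by simp
  ultimately show False unfolding sum_degrees[OF G] by linarith
qed

lemma card_eulerian_orientations_le:
  fixes M :: "nat planar_map"
  assumes "M \<in> planar_maps n"
  shows "real (card (eulerian_orientations M)) \<le> 3.73 ^ n"
proof -
  have M: "is_planar_map M" and n: "card (verts M) = n" using assms by (simp_all add: planar_maps_def)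
  interpret plane_graph "verts M" "edges M" "point_of M" "arc_of M"
    using M by unfold_locales (simp_all add: is_planar_map_def)
  let ?V = "verts M" and ?E = "edges M"
  let ?\<kappa> = "card (graph_components ?V ?E)"
  let ?O = "orientations_with_out_degrees ?E ?V (\<lambda>v. vertex_degree M v div 2)"
  have "eulerian_orientations M \<subseteq> ?O"
  proof
    fix A assume A: "A \<in> eulerian_orientations M"
    have "out_degree A v = vertex_degree M v div 2" if "v \<in> ?V" for v
    proof -
      have "real (2 * out_degree A v) = real (vertex_degree M v)"
        using A that by (simp add: eulerian_orientations_def mult.commute)
      then have "2 * out_degree A v = vertex_degree M v" by (simp only: of_nat_eq_iff)
      then show ?thesis by simp
    qed
    then show "A \<in> ?O"
      using A by (simp add: eulerian_orientations_def orientation_def orientations_with_out_degrees_def)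
  qed
  then have "card (eulerian_orientations M) \<le> card ?O" by (rule card_mono[OF finite_orientations[OF simple]])
  then have "real (card (eulerian_orientations M)) \<le> real (card ?O)" by simp
  also have "\<dots> \<le> (7/4)^card ?E * (3/2)^?\<kappa> / (3/2)^card ?V"
    by (rule card_orientations_with_out_degrees_le[OF simple low_degree_vertex])
  also have "\<dots> = (7/4)^card ?E / (3/2)^(n - ?\<kappa>)"
  proof -
    have "?\<kappa> \<le> n" using plane_graph_card_edges_le[OF plane_graph_axioms] n by linarith
    then show ?thesis unfolding n by (simp add: power_diff)
  qed
  also have "\<dots> \<le> (7/4)^(3 * (n - ?\<kappa>)) / (3/2)^(n - ?\<kappa>)"
    using plane_graph_card_edges_le[OF plane_graph_axioms] n
    by (intro divide_right_mono power_increasing) auto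
  also have "\<dots> = ((7/4)^3 / (3/2))^(n - ?\<kappa>)" by (simp only: power_mult power_divide)
  also have "\<dots> \<le> 3.73^(n - ?\<kappa>)" by (intro power_mono) (simp_all add: power3_eq_cube)
  also have "\<dots> \<le> 3.73^n" by (intro power_increasing) simp_all
  finally show ?thesis .
qed

section \<open>Noncrossing segments between three rays\<close>

text \<open>
  Any three directions that positively span the plane would do.  These have integer coordinates and sum
  to zero.
\<close>

definition spiral_dir :: "nat \<Rightarrow> complex" where
  "spiral_dir r = (if r = 0 then 1 else if r = 1 then \<i> else - 1 - \<i>)"

definition spiral_point :: "nat \<Rightarrow> complex" where
  "spiral_point i = of_nat (i + 1) * spiral_dir (i mod 3)"

text \<open>
  Every point of the plane is a combination of the three directions with nonnegative coefficients, and
  exactly one such combination has a coefficient 0, as the directions sum to zero.  These are its coefficients: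
  adding the same amount to all of them does not change the point, so the smallest is normalised to 0.  A point
  on a segment between two rays can then be compared with a point on any other segment.
\<close>

definition ray_coord :: "complex \<Rightarrow> nat \<Rightarrow> real" where
  "ray_coord z r = (if r = 0 then Re z else if r = 1 then Im z else 0) - min 0 (min (Re z) (Im z))"

lemma ray_coord_cone:
  assumes "0 \<le> a" "0 \<le> b" "q < 3" "r < 3" "k < 3"
  shows "ray_coord (of_real a * spiral_dir q + of_real b * spiral_dir r) k
    = (if q = k then a else 0) + (if r = k then b else 0)"
proof -
  have "q \<in> {0, 1, 2}" "r \<in> {0, 1, 2}" "k \<in> {0, 1, 2}" using assms by auto
  then show ?thesis
    using assms(1,2) unfolding ray_coord_def spiral_dir_def min_def
    by (elim insertE emptyE) simp_all
qed

lemma ray_coord_segment: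
  assumes "0 \<le> t" "t \<le> 1" "k < 3"
  shows "ray_coord ((1 - t) *\<^sub>R spiral_point i + t *\<^sub>R spiral_point j) k
    = (if i mod 3 = k then (1 - t) * (real i + 1) else 0) + (if j mod 3 = k then t * (real j + 1) else 0)"
proof -
  have "(1 - t) *\<^sub>R spiral_point i + t *\<^sub>R spiral_point j
      = of_real ((1 - t) * (real i + 1)) * spiral_dir (i mod 3) + of_real (t * (real j + 1)) * spiral_dir (j mod 3)"
    by (simp add: spiral_point_def scaleR_conv_of_real algebra_simps)
  then show ?thesis
    using ray_coord_cone[of "(1 - t) * (real i + 1)" "t * (real j + 1)" "i mod 3" "j mod 3" k] assms
    by simp
qed

lemma ray_coord_point:
  assumes "k < 3"
  shows "ray_coord (spiral_point v) k = (if v mod 3 = k then real v + 1 else 0)"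
  using ray_coord_segment[of 0 k v v] assms by simp

lemma inj_spiral_point: "inj spiral_point"
proof (rule injI)
  fix v w assume eq: "spiral_point v = spiral_point w"
  have "ray_coord (spiral_point v) (v mod 3) = ray_coord (spiral_point w) (v mod 3)" using eq by simp
  then show "v = w" by (simp add: ray_coord_point split: if_splits)
qed

lemma mod3_eq_less: "a < b \<Longrightarrow> a mod 3 = b mod 3 \<Longrightarrow> a + 3 \<le> b" for a b :: nat
  using mod_eq_dvd_iff_nat[of a b 3] dvd_imp_le[of 3 "b - a"] by simp

lemma mod3_eq_le: "b < a + 3 \<Longrightarrow> a mod 3 = b mod 3 \<Longrightarrow> b \<le> a" for a b :: nat
  using mod3_eq_less[of a b] by linarith

lemma mod3_eq_close: "a < b + 3 \<Longrightarrow> b < a + 3 \<Longrightarrow> a mod 3 = b mod 3 \<Longrightarrow> a = b" for a b :: nat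
  using mod3_eq_le[of a b] mod3_eq_le[of b a] by linarith

lemma spiral_point_on_segment:
  assumes ij: "i < j" "j \<le> i + 3" and v: "spiral_point v \<in> closed_segment (spiral_point i) (spiral_point j)"
  shows "v = i \<or> v = j"
proof (rule ccontr)
  assume neq: "\<not> (v = i \<or> v = j)"
  obtain t where t: "0 \<le> t" "t \<le> 1" "spiral_point v = (1 - t) *\<^sub>R spiral_point i + t *\<^sub>R spiral_point j"
    using v unfolding in_segment by blast
  have "t \<noteq> 0" "t \<noteq> 1" using t(3) neq inj_spiral_point by (auto dest: injD)
  then have t': "0 < t" "t < 1" using t by auto
  have eq: "(if v mod 3 = k then real v + 1 else 0)
      = (if i mod 3 = k then (1 - t) * (real i + 1) else 0) + (if j mod 3 = k then t * (real j + 1) else 0)"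
    if "k < 3" for k
    using ray_coord_point[OF that, of v] ray_coord_segment[OF t(1,2) that, of i j] t(3) by simp
  have pos: "0 < (1 - t) * (real i + 1)" "0 < t * (real j + 1)" using t' by simp_all
  have vi: "v mod 3 = i mod 3" using eq[of "i mod 3"] pos by (auto split: if_splits)
  have vj: "v mod 3 = j mod 3" using eq[of "j mod 3"] pos by (auto split: if_splits)
  have "j = i + 3" using mod3_eq_less[OF ij(1)] vi vj ij by simp
  then have "real v = real i + 3 * t" using eq[of "v mod 3"] vi vj by (simp add: algebra_simps)
  then have "real i < real v" "real v < real (i + 3)" using t' by simp_all
  then have "i < v" "v < i + 3" by linarith+
  then show False using mod3_eq_less[of i v] vi by simp
qed

lemma mult_eq_less:
  fixes a b x y :: real
  assumes "a * x = b * y" "x < y" "0 < x" "0 < b"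
  shows "b < a"
proof (rule ccontr)
  assume "\<not> b < a"
  then have "a * x \<le> b * x" using assms(3) by (intro mult_right_mono) simp_all
  also have "\<dots> < b * y" using assms by simp
  finally show False using assms(1) by simp
qed

text \<open>
  Two crossing segments join the same two rays, because the positive coordinates determine the rays.  On a
  single ray the segments are consecutive intervals of length 3.  Between two different rays the segments form a
  zigzag: of two of them, one has both of its ends at least as far out as the other on the respective rays, and
  one of these strictly farther.  At a common interior point the barycentric coordinates of the farther one would
  then sum to less than 1.
\<close>

lemma spiral_segments_cross:
  assumes ij: "i < j" "j \<le> i + 3" and kl: "k < l" "l \<le> k + 3" and ne: "(i, j) \<noteq> (k, l)"
    and s: "0 < s" "s < 1" and t: "0 < t" "t < 1"
    and eq: "(1 - s) *\<^sub>R spiral_point i + s *\<^sub>R spiral_point j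
      = (1 - t) *\<^sub>R spiral_point k + t *\<^sub>R spiral_point l"
  shows False
proof -
  have coord: "(if i mod 3 = q then (1 - s) * (real i + 1) else 0) + (if j mod 3 = q then s * (real j + 1) else 0)
      = (if k mod 3 = q then (1 - t) * (real k + 1) else 0) + (if l mod 3 = q then t * (real l + 1) else 0)"
    if "q < 3" for q
    using ray_coord_segment[of s q i j] ray_coord_segment[of t q k l] s t that eq by simp
  have pos: "0 < (1 - s) * (real i + 1)" "0 < s * (real j + 1)"
    "0 < (1 - t) * (real k + 1)" "0 < t * (real l + 1)" using s t by simp_all
  have mem: "i mod 3 = k mod 3 \<or> i mod 3 = l mod 3" "j mod 3 = k mod 3 \<or> j mod 3 = l mod 3"
    "k mod 3 = i mod 3 \<or> k mod 3 = j mod 3" "l mod 3 = i mod 3 \<or> l mod 3 = j mod 3"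
    subgoal using coord[of "i mod 3"] pos by (auto split: if_splits)
    subgoal using coord[of "j mod 3"] pos by (auto split: if_splits)
    subgoal using coord[of "k mod 3"] pos by (auto split: if_splits)
    subgoal using coord[of "l mod 3"] pos by (auto split: if_splits)
    done
  show False
  proof (cases "i mod 3 = j mod 3")
    case True
    then have j: "j = i + 3" using mod3_eq_less[of i j] ij by simp
    have kl_mod: "k mod 3 = i mod 3" "l mod 3 = i mod 3" using mem True by metis+
    then have l: "l = k + 3" using mod3_eq_less[of k l] kl by simp
    have jm: "j mod 3 = i mod 3" using True by simp
    have "(1 - s) * (real i + 1) + s * (real j + 1) = (1 - t) * (real k + 1) + t * (real l + 1)"
      using coord[of "i mod 3"] by (simp add: kl_mod jm)
    then have "real i + 3 * s = real k + 3 * t" by (simp add: j l algebra_simps)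
    then have "real i < real (k + 3)" "real k < real (i + 3)" using s t by auto
    then have "i < k + 3" "k < i + 3" by linarith+
    then have "i = k" by (rule mod3_eq_close) (simp add: kl_mod)
    then show False using ne j l by simp
  next
    case ij_mod: False
    then have kl_mod: "k mod 3 \<noteq> l mod 3" using mem by metis
    show False
    proof (cases "i mod 3 = k mod 3")
      case True
      then have jl: "j mod 3 = l mod 3" using mem ij_mod kl_mod by metis+
      have 1: "(1 - s) * (real i + 1) = (1 - t) * (real k + 1)"
        using coord[of "k mod 3"] kl_mod by (simp add: True jl)
      have 2: "s * (real j + 1) = t * (real l + 1)"
        using coord[of "l mod 3"] kl_mod by (simp add: True jl)
      have nj: "j < i + 3" "l < k + 3" using ij kl ij_mod kl_mod by (auto simp: order.strict_iff_order)
      consider "i < k" | "k < i" | "i = k" by linarith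
      then show False
      proof cases
        assume "i < k"
        then have "j < l" using mod3_eq_less[OF _ True] nj kl by linarith
        have "1 - t < 1 - s" by (rule mult_eq_less[OF 1]) (use \<open>i < k\<close> t in simp_all)
        moreover have "t < s" by (rule mult_eq_less[OF 2]) (use \<open>j < l\<close> t in simp_all)
        ultimately show False by simp
      next
        assume "k < i"
        then have "l < j" using mod3_eq_less[OF _ True[symmetric]] nj ij by linarith
        have "1 - s < 1 - t" by (rule mult_eq_less[OF 1[symmetric]]) (use \<open>k < i\<close> s in simp_all)
        moreover have "s < t" by (rule mult_eq_less[OF 2[symmetric]]) (use \<open>l < j\<close> s in simp_all)
        ultimately show False by simp
      next
        assume "i = k"
        have "j = l" by (rule mod3_eq_close[OF _ _ jl]) (use ij kl \<open>i = k\<close> in linarith)+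
        then show False using ne \<open>i = k\<close> by blast
      qed
    next
      case False
      then have il: "i mod 3 = l mod 3" and jk: "j mod 3 = k mod 3" using mem ij_mod kl_mod by metis+
      have 1: "(1 - s) * (real i + 1) = t * (real l + 1)"
        using coord[of "l mod 3"] kl_mod by (simp add: il jk)
      have 2: "s * (real j + 1) = (1 - t) * (real k + 1)"
        using coord[of "k mod 3"] kl_mod by (simp add: il jk)
      have "i \<noteq> k" using False by blast
      then consider "i < k" | "k < i" by linarith
      then show False
      proof cases
        assume "i < k"
        have "i < l" using \<open>i < k\<close> kl by linarith
        have "j \<le> k" by (rule mod3_eq_le[OF _ jk[symmetric]]) (use ij \<open>i < k\<close> in linarith)
        have "t < 1 - s" by (rule mult_eq_less[OF 1]) (use \<open>i < l\<close> t in simp_all)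
        moreover have "1 - t \<le> s"
        proof (cases "j = k")
          case True
          then show ?thesis using 2 by simp
        next
          case False
          have "1 - t < s" by (rule mult_eq_less[OF 2]) (use False \<open>j \<le> k\<close> t in simp_all)
          then show ?thesis by simp
        qed
        ultimately show False by simp
      next
        assume "k < i"
        have "k < j" using \<open>k < i\<close> ij by linarith
        have "l \<le> i" by (rule mod3_eq_le[OF _ il]) (use kl \<open>k < i\<close> in linarith)
        have "s < 1 - t" by (rule mult_eq_less[OF 2[symmetric]]) (use \<open>k < j\<close> s in simp_all)
        moreover have "1 - s \<le> t"
        proof (cases "l = i")
          case True
          then show ?thesis using 1 by simp
        next
          case False
          have "1 - s < t" by (rule mult_eq_less[OF 1[symmetric]]) (use False \<open>l \<le> i\<close> s in simp_all)
          then show ?thesis by simp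
        qed
        ultimately show False by simp
      qed
    qed
  qed
qed

lemma spiral_segments_meet:
  assumes ij: "i < j" "j \<le> i + 3" and kl: "k < l" "l \<le> k + 3" and ne: "(i, j) \<noteq> (k, l)"
  shows "closed_segment (spiral_point i) (spiral_point j) \<inter> closed_segment (spiral_point k) (spiral_point l)
    \<subseteq> spiral_point ` ({i, j} \<inter> {k, l})"
proof
  fix z assume z: "z \<in> closed_segment (spiral_point i) (spiral_point j)
    \<inter> closed_segment (spiral_point k) (spiral_point l)"
  then have z1: "z \<in> closed_segment (spiral_point i) (spiral_point j)"
    and z2: "z \<in> closed_segment (spiral_point k) (spiral_point l)" by simp_all
  obtain s where s: "0 \<le> s" "s \<le> 1" "z = (1 - s) *\<^sub>R spiral_point i + s *\<^sub>R spiral_point j"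
    using z1 unfolding in_segment by auto
  obtain t where t: "0 \<le> t" "t \<le> 1" "z = (1 - t) *\<^sub>R spiral_point k + t *\<^sub>R spiral_point l"
    using z2 unfolding in_segment by auto
  have "\<not> (0 < s \<and> s < 1 \<and> 0 < t \<and> t < 1)"
    using spiral_segments_cross[OF ij kl ne, of s t] unfolding s(3)[symmetric] t(3)[symmetric] by blast
  then have "s = 0 \<or> s = 1 \<or> t = 0 \<or> t = 1" using s t by linarith
  then have "\<exists>v\<in>{i, j} \<union> {k, l}. z = spiral_point v"
    using s(3) t(3) by (elim disjE) simp_all
  then obtain v where v: "v \<in> {i, j} \<union> {k, l}" "z = spiral_point v" by blast
  then have "v = i \<or> v = j" "v = k \<or> v = l"
    using spiral_point_on_segment[OF ij, of v] spiral_point_on_segment[OF kl, of v] z1 z2 by simp_all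
  then show "z \<in> spiral_point ` ({i, j} \<inter> {k, l})" using v(2) by blast
qed

section \<open>The spiral graph\<close>

text \<open>
  Without the two exceptional pairs, the vertices 0, 2 and their mirror images would have odd degrees 3 and 5.
\<close>

definition spiral_edge :: "nat \<Rightarrow> nat \<Rightarrow> nat \<Rightarrow> bool" where
  "spiral_edge m i j \<longleftrightarrow> i < j \<and> j \<le> i + 3 \<and> j < m + 6 \<and> (i, j) \<noteq> (0, 2) \<and> (i, j) \<noteq> (m + 3, m + 5)"

definition spiral_map :: "nat \<Rightarrow> nat planar_map" where
  "spiral_map m = \<lparr>verts = {..<m + 6}, edges = {{i, j} | i j. spiral_edge m i j},
     point_of = spiral_point,
     arc_of = (\<lambda>e. linepath (spiral_point (Min e)) (spiral_point (Max e)))\<rparr>"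

lemma spiral_map_planar: "spiral_map m \<in> planar_maps (m + 6)"
proof -
  let ?E = "edges (spiral_map m)" and ?g = "arc_of (spiral_map m)"
  have E: "\<exists>i j. e = {i, j} \<and> i < j \<and> j \<le> i + 3 \<and> j < m + 6
      \<and> ?g e = linepath (spiral_point i) (spiral_point j)" if "e \<in> ?E" for e
  proof -
    obtain i j where ij: "e = {i, j}" "spiral_edge m i j" using \<open>e \<in> ?E\<close> by (auto simp: spiral_map_def)
    then have "i < j" "j \<le> i + 3" "j < m + 6" by (simp_all add: spiral_edge_def)
    moreover have "Min e = i" "Max e = j" using ij(1) \<open>i < j\<close> by simp_all
    ultimately show ?thesis using ij(1) by (intro exI[of _ i] exI[of _ j]) (simp add: spiral_map_def)
  qed
  have "simple_graph {..<m + 6} ?E"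
    unfolding simple_graph_def
  proof (intro conjI ballI)
    fix e assume "e \<in> ?E"
    then obtain i j where "e = {i, j}" "i < j" "j < m + 6" using E by blast
    then show "\<exists>u\<in>{..<m + 6}. \<exists>v\<in>{..<m + 6}. u \<noteq> v \<and> e = {u, v}"
      by (intro bexI[of _ i] bexI[of _ j]) auto
  qed simp
  moreover have "plane_embedding {..<m + 6} ?E spiral_point ?g"
    unfolding plane_embedding_def
  proof (intro conjI ballI impI)
    show "inj_on spiral_point {..<m + 6}" using inj_spiral_point inj_on_subset by blast
  next
    fix e assume "e \<in> ?E"
    then obtain i j where e: "e = {i, j}" "i < j" "j \<le> i + 3"
      and g: "?g e = linepath (spiral_point i) (spiral_point j)" using E by blast
    show "arc (?g e)" unfolding g using e inj_spiral_point by (intro arc_linepath) (auto dest: injD)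
    show "{pathstart (?g e), pathfinish (?g e)} = spiral_point ` e" unfolding g using e by simp
    show "v \<in> e" if "spiral_point v \<in> path_image (?g e)" for v
      using spiral_point_on_segment[OF e(2,3)] that e unfolding g by auto
    fix f assume "f \<in> ?E" "e \<noteq> f"
    then obtain k l where f: "f = {k, l}" "k < l" "l \<le> k + 3"
      and h: "?g f = linepath (spiral_point k) (spiral_point l)" using E by blast
    show "path_image (?g e) \<inter> path_image (?g f) \<subseteq> spiral_point ` (e \<inter> f)"
      using spiral_segments_meet[OF e(2,3) f(2,3)] \<open>e \<noteq> f\<close> e f unfolding g h by auto
  qed
  ultimately show ?thesis
    by (simp add: planar_maps_def is_planar_map_def spiral_map_def)
qed

section \<open>Walks on the states of a cut\<close>

text \<open>
  The choice at vertex \<open>i\<close> tells which of the edges to \<open>i + 1\<close>, \<open>i + 2\<close> and \<open>i + 3\<close> leave \<open>i\<close>.  The state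
  \<open>(a, b, c)\<close> at the cut before \<open>i\<close> counts the arrows from earlier vertices into \<open>i\<close>, \<open>i + 1\<close> and \<open>i + 2\<close>.  An
  inner vertex \<open>i\<close> has three earlier and three later neighbours, so it is balanced if and only if exactly \<open>a\<close> edges to later
  neighbours leave it.
\<close>

type_synonym choice = "bool \<times> bool \<times> bool"

fun count_out :: "choice \<Rightarrow> nat" where
  "count_out (x, y, z) = of_bool x + of_bool y + of_bool z"

fun next_flow :: "nat \<times> nat \<times> nat \<Rightarrow> choice \<Rightarrow> nat \<times> nat \<times> nat" where
  "next_flow (a, b, c) (x, y, z) = (b + of_bool x, c + of_bool y, of_bool z)"

text \<open>
  The state \<open>(1, 1, 1)\<close> is the one that the last three vertices of the spiral can absorb.
\<close>

fun flow_run :: "nat \<times> nat \<times> nat \<Rightarrow> choice list \<Rightarrow> bool" where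
  "flow_run s [] \<longleftrightarrow> s = (1, 1, 1)"
| "flow_run s (t # ts) \<longleftrightarrow> count_out t = fst s \<and> flow_run (next_flow s t) ts"

definition flow_runs :: "nat \<Rightarrow> nat \<times> nat \<times> nat \<Rightarrow> choice list set" where
  "flow_runs m s = {ts. length ts = m \<and> flow_run s ts}"

lemma finite_flow_runs: "finite (flow_runs m s)"
  by (rule finite_subset[OF _ finite_lists_length_eq[of UNIV m]]) (auto simp: flow_runs_def)

lemma card_flow_runs_0: "card (flow_runs 0 s) = of_bool (s = (1, 1, 1))"
proof -
  have "flow_runs 0 s = (if s = (1, 1, 1) then {[]} else {})" by (auto simp: flow_runs_def)
  then show ?thesis by simp
qed

lemma card_flow_runs_Suc:
  "card (flow_runs (Suc m) s) = (\<Sum>t\<in>UNIV. if count_out t = fst s then card (flow_runs m (next_flow s t)) else 0)"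
proof -
  let ?T = "{t. count_out t = fst s}"
  have "flow_runs (Suc m) s = (\<Union>t\<in>?T. (#) t ` flow_runs m (next_flow s t))"
  proof (intro equalityI subsetI)
    fix x assume "x \<in> flow_runs (Suc m) s"
    then have x: "length x = Suc m" "flow_run s x" by (simp_all add: flow_runs_def)
    obtain t us where tu: "x = t # us" "length us = m" using x(1) by (cases x) simp_all
    then have "t \<in> ?T" "us \<in> flow_runs m (next_flow s t)" using x(2) by (simp_all add: flow_runs_def)
    then show "x \<in> (\<Union>t\<in>?T. (#) t ` flow_runs m (next_flow s t))" unfolding tu(1) by blast
  next
    fix x assume "x \<in> (\<Union>t\<in>?T. (#) t ` flow_runs m (next_flow s t))"
    then obtain t us where "x = t # us" "count_out t = fst s" "us \<in> flow_runs m (next_flow s t)" by blast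
    then show "x \<in> flow_runs (Suc m) s" by (simp add: flow_runs_def)
  qed
  also have "card \<dots> = (\<Sum>t\<in>?T. card ((#) t ` flow_runs m (next_flow s t)))"
    by (rule card_UN_disjoint) (auto simp: finite_flow_runs)
  also have "\<dots> = (\<Sum>t\<in>?T. card (flow_runs m (next_flow s t)))"
    by (simp add: card_image)
  also have "\<dots> = (\<Sum>t\<in>UNIV. if count_out t = fst s then card (flow_runs m (next_flow s t)) else 0)"
    by (simp add: sum.If_cases)
  finally show ?thesis .
qed

lemma sum_choices:
  "(\<Sum>t\<in>UNIV. f t) = f (True, True, True) + f (True, True, False) + f (True, False, True) + f (True, False, False)
    + f (False, True, True) + f (False, True, False) + f (False, False, True) + (f (False, False, False) :: nat)"
proof -
  have "(\<Sum>t\<in>UNIV. f t) = (\<Sum>x\<in>UNIV. \<Sum>y\<in>UNIV. \<Sum>z\<in>UNIV. f (x, y, z))"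
    by (simp add: UNIV_Times_UNIV[symmetric] sum.cartesian_product' del: UNIV_Times_UNIV)
  then show ?thesis by (simp add: UNIV_bool)
qed

lemma card_flow_runs_rec:
  "card (flow_runs (Suc m) (3, 0, 0)) = card (flow_runs m (1, 1, 1))"
  "card (flow_runs (Suc m) (2, 1, 0)) =
     card (flow_runs m (2, 1, 0)) + card (flow_runs m (2, 0, 1)) + card (flow_runs m (1, 1, 1))"
  "card (flow_runs (Suc m) (2, 0, 1)) =
     card (flow_runs m (1, 2, 0)) + card (flow_runs m (1, 1, 1)) + card (flow_runs m (0, 2, 1))"
  "card (flow_runs (Suc m) (1, 2, 0)) =
     card (flow_runs m (3, 0, 0)) + card (flow_runs m (2, 1, 0)) + card (flow_runs m (2, 0, 1))"
  "card (flow_runs (Suc m) (1, 1, 1)) =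
     card (flow_runs m (2, 1, 0)) + card (flow_runs m (1, 2, 0)) + card (flow_runs m (1, 1, 1))"
  "card (flow_runs (Suc m) (0, 2, 1)) = card (flow_runs m (2, 1, 0))"
  by (simp_all add: card_flow_runs_Suc sum_choices numeral_2_eq_2 numeral_3_eq_3)

text \<open>
  The vector \<open>(3, 10, 7, 7, 10, 3)\<close> approximates the Perron eigenvector of the transfer matrix and is
  multiplied by at least 2.7 in each step.  Two steps are needed at the start for all counts to be positive.
\<close>

lemma card_flow_runs_ge:
  "3 * 2.7 ^ m \<le> 10 * real (card (flow_runs (Suc (Suc m)) (3, 0, 0)))"
  "10 * 2.7 ^ m \<le> 10 * real (card (flow_runs (Suc (Suc m)) (2, 1, 0)))"
  "7 * 2.7 ^ m \<le> 10 * real (card (flow_runs (Suc (Suc m)) (2, 0, 1)))"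
  "7 * 2.7 ^ m \<le> 10 * real (card (flow_runs (Suc (Suc m)) (1, 2, 0)))"
  "10 * 2.7 ^ m \<le> 10 * real (card (flow_runs (Suc (Suc m)) (1, 1, 1)))"
  "3 * 2.7 ^ m \<le> 10 * real (card (flow_runs (Suc (Suc m)) (0, 2, 1)))"
proof (induction m)
  case 0
  {
    case 1 show ?case unfolding card_flow_runs_rec card_flow_runs_0 by simp
  next
    case 2 show ?case unfolding card_flow_runs_rec card_flow_runs_0 by simp
  next
    case 3 show ?case unfolding card_flow_runs_rec card_flow_runs_0 by simp
  next
    case 4 show ?case unfolding card_flow_runs_rec card_flow_runs_0 by simp
  next
    case 5 show ?case unfolding card_flow_runs_rec card_flow_runs_0 by simp
  next
    case 6 show ?case unfolding card_flow_runs_rec card_flow_runs_0 by simp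
  }
next
  case (Suc m)
  define x :: real where "x = 2.7 ^ m"
  have pos: "0 < x" and x: "2.7 ^ Suc m = 2.7 * x" by (simp_all add: x_def)
  note IH = Suc[folded x_def]
  {
    case 1 show ?case using IH(5) pos unfolding card_flow_runs_rec[of "Suc (Suc m)"] of_nat_add x by simp
  next
    case 2 show ?case using IH(2,3,5) pos unfolding card_flow_runs_rec[of "Suc (Suc m)"] of_nat_add x by simp
  next
    case 3 show ?case using IH(4,5,6) pos unfolding card_flow_runs_rec[of "Suc (Suc m)"] of_nat_add x by simp
  next
    case 4 show ?case using IH(1,2,3) pos unfolding card_flow_runs_rec[of "Suc (Suc m)"] of_nat_add x by simp
  next
    case 5 show ?case using IH(2,4,5) pos unfolding card_flow_runs_rec[of "Suc (Suc m)"] of_nat_add x by simp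
  next
    case 6 show ?case using IH(2) pos unfolding card_flow_runs_rec[of "Suc (Suc m)"] of_nat_add x by simp
  }
qed

section \<open>Eulerian orientations of the spiral graph\<close>

text \<open>
  The choices at the first three vertices lead to the state \<open>(2, 1, 0)\<close>, and those at the last three let all
  edges to later vertices point backwards.
\<close>

definition choice_at :: "choice list \<Rightarrow> nat \<Rightarrow> choice" where
  "choice_at ts i = (if i = 0 then (True, False, False) else if i \<le> 2 then (True, True, False)
     else if i < length ts + 3 then ts ! (i - 3) else (False, False, False))"

fun choice_bit :: "choice \<Rightarrow> nat \<Rightarrow> bool" where
  "choice_bit (x, y, z) d = (if d = 1 then x else if d = 2 then y else z)"

definition forward :: "choice list \<Rightarrow> nat \<Rightarrow> nat \<Rightarrow> bool" where
  "forward ts i d = choice_bit (choice_at ts i) d"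

definition spiral_orientation :: "choice list \<Rightarrow> (nat \<times> nat) set" where
  "spiral_orientation ts =
     {(i, j). spiral_edge (length ts) i j \<and> forward ts i (j - i)} \<union>
     {(j, i). spiral_edge (length ts) i j \<and> \<not> forward ts i (j - i)}"

lemma forward_bits:
  "forward ts i 1 = fst (choice_at ts i)" "forward ts i 2 = fst (snd (choice_at ts i))"
  "forward ts i 3 = snd (snd (choice_at ts i))"
  unfolding forward_def by (cases "choice_at ts i"; simp)+

lemma count_out_forward:
  "count_out (choice_at ts i) = of_bool (forward ts i 1) + of_bool (forward ts i 2) + of_bool (forward ts i 3)"
  unfolding forward_bits by (cases "choice_at ts i") simp

text \<open>
  The state at the cut before vertex \<open>k + 3\<close>.
\<close>

definition flow_at :: "choice list \<Rightarrow> nat \<Rightarrow> nat \<times> nat \<times> nat" where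
  "flow_at ts k =
     (of_bool (forward ts (k + 2) 1) + of_bool (forward ts (k + 1) 2) + of_bool (forward ts k 3),
      of_bool (forward ts (k + 2) 2) + of_bool (forward ts (k + 1) 3), of_bool (forward ts (k + 2) 3))"

lemma next_flow_at: "next_flow (flow_at ts k) (choice_at ts (k + 3)) = flow_at ts (Suc k)"
proof -
  have "choice_at ts (k + 3) = (forward ts (k + 3) 1, forward ts (k + 3) 2, forward ts (k + 3) 3)"
    unfolding forward_bits by simp
  then show ?thesis by (simp add: flow_at_def add.commute numeral_eq_Suc)
qed

lemma flow_at_0: "flow_at ts 0 = (2, 1, 0)"
  by (simp add: flow_at_def forward_def choice_at_def)

lemma flow_run_drop:
  assumes "flow_run (2, 1, 0) ts" "k \<le> length ts"
  shows "flow_run (flow_at ts k) (drop k ts)"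
  using assms(2)
proof (induction k)
  case 0
  then show ?case using assms(1) flow_at_0[of ts] by simp
next
  case (Suc k)
  have "drop k ts = choice_at ts (k + 3) # drop (Suc k) ts"
    using Suc.prems by (simp add: choice_at_def Cons_nth_drop_Suc)
  then have "flow_run (flow_at ts k) (choice_at ts (k + 3) # drop (Suc k) ts)"
    using Suc by simp
  then have "flow_run (next_flow (flow_at ts k) (choice_at ts (k + 3))) (drop (Suc k) ts)" by simp
  then show ?case by (simp only: next_flow_at)
qed

lemma flow_run_balance:
  assumes "flow_run (2, 1, 0) ts"
  shows "k < length ts \<Longrightarrow> count_out (choice_at ts (k + 3)) = fst (flow_at ts k)"
    and "flow_at ts (length ts) = (1, 1, 1)"
proof -
  assume k: "k < length ts"
  have "drop k ts = choice_at ts (k + 3) # drop (Suc k) ts"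
    using k by (simp add: choice_at_def Cons_nth_drop_Suc)
  then show "count_out (choice_at ts (k + 3)) = fst (flow_at ts k)"
    using flow_run_drop[OF assms, of k] k by simp
next
  show "flow_at ts (length ts) = (1, 1, 1)" using flow_run_drop[OF assms, of "length ts"] by simp
qed

lemma card_near:
  fixes v :: nat
  assumes "\<And>w. Q w \<Longrightarrow> w \<noteq> v \<and> w \<le> v + 3 \<and> v \<le> w + 3"
  shows "card {w. Q w} = of_bool (Q (v + 1)) + of_bool (Q (v + 2)) + of_bool (Q (v + 3))
    + of_bool (1 \<le> v \<and> Q (v - 1)) + of_bool (2 \<le> v \<and> Q (v - 2)) + of_bool (3 \<le> v \<and> Q (v - 3))"
proof -
  define P where "P d = {w. w = v + d \<and> Q w}" for d
  define M where "M d = {w. w + d = v \<and> Q w}" for d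
  have "{w. Q w} = P 1 \<union> P 2 \<union> P 3 \<union> M 1 \<union> M 2 \<union> M 3"
  proof (intro equalityI subsetI)
    fix w assume "w \<in> {w. Q w}"
    then have "Q w" "w \<noteq> v" "w \<le> v + 3" "v \<le> w + 3" using assms by auto
    then have "w = v + 1 \<or> w = v + 2 \<or> w = v + 3 \<or> w + 1 = v \<or> w + 2 = v \<or> w + 3 = v" by linarith
    then show "w \<in> P 1 \<union> P 2 \<union> P 3 \<union> M 1 \<union> M 2 \<union> M 3" using \<open>Q w\<close> by (auto simp: P_def M_def)
  qed (auto simp: P_def M_def)
  moreover have P: "finite (P d) \<and> card (P d) = of_bool (Q (v + d))" for d
  proof -
    have "P d = (if Q (v + d) then {v + d} else {})" by (auto simp: P_def)
    then show ?thesis by auto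
  qed
  moreover have M: "finite (M d) \<and> card (M d) = of_bool (d \<le> v \<and> Q (v - d))" for d
  proof -
    have "M d = (if d \<le> v \<and> Q (v - d) then {v - d} else {})" by (auto simp: M_def)
    then show ?thesis by auto
  qed
  moreover have "card (P 1 \<union> P 2 \<union> P 3 \<union> M 1 \<union> M 2 \<union> M 3)
    = card (P 1) + card (P 2) + card (P 3) + card (M 1) + card (M 2) + card (M 3)"
  proof -
    have "P a \<inter> P b = {}" "M a \<inter> M b = {}" if "a \<noteq> b" for a b using that by (auto simp: P_def M_def)
    moreover have "P a \<inter> M b = {}" if "0 < a" for a b using that by (auto simp: P_def M_def)
    ultimately show ?thesis
      by (simp add: card_Un_disjoint P M Int_Un_distrib2 del: One_nat_def)
  qed
  ultimately show ?thesis by simp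
qed

lemma orientation_vertex_degree:
  assumes "is_planar_map M" "orientation M A"
  shows "vertex_degree M v = card {w. (v, w) \<in> A} + card {w. (w, v) \<in> A}"
proof -
  have G: "simple_graph (verts M) (edges M)" using assms(1) by (simp add: is_planar_map_def)
  have E: "{x, y} \<in> edges M" if "(x, y) \<in> A" for x y
    using assms(2) that unfolding orientation_def by auto
  have anti: "(x, y) \<in> A \<longleftrightarrow> (y, x) \<notin> A" if "{x, y} \<in> edges M" for x y
    using assms(2) that unfolding orientation_def by auto
  have fin: "finite (verts M)" using G by (simp add: simple_graph_def)
  have "{e \<in> edges M. v \<in> e} = (\<lambda>w. {v, w}) ` ({w. (v, w) \<in> A} \<union> {w. (w, v) \<in> A})"
  proof (intro equalityI subsetI)
    fix e assume e: "e \<in> {e \<in> edges M. v \<in> e}"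
    then obtain x y where "e = {x, y}" using simple_graph_edgeE[OF G] by blast
    then obtain w where w: "e = {v, w}" using e by auto
    then have "(v, w) \<in> A \<or> (w, v) \<in> A" using anti[of v w] e by blast
    then show "e \<in> (\<lambda>w. {v, w}) ` ({w. (v, w) \<in> A} \<union> {w. (w, v) \<in> A})" using w by blast
  next
    fix e assume "e \<in> (\<lambda>w. {v, w}) ` ({w. (v, w) \<in> A} \<union> {w. (w, v) \<in> A})"
    then obtain w where "e = {v, w}" "(v, w) \<in> A \<or> (w, v) \<in> A" by blast
    then show "e \<in> {e \<in> edges M. v \<in> e}" using E[of v w] E[of w v] by (auto simp: insert_commute)
  qed
  moreover have "inj_on (\<lambda>w. {v, w}) X" for X by (auto simp: inj_on_def doubleton_eq_iff)
  ultimately have "vertex_degree M v = card ({w. (v, w) \<in> A} \<union> {w. (w, v) \<in> A})"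
    unfolding vertex_degree_def by (simp add: card_image)
  also have "\<dots> = card {w. (v, w) \<in> A} + card {w. (w, v) \<in> A}"
  proof (rule card_Un_disjoint)
    have "{w. (v, w) \<in> A} \<subseteq> verts M" "{w. (w, v) \<in> A} \<subseteq> verts M"
      using simple_graph_neighbour[OF G] E by blast+
    then show "finite {w. (v, w) \<in> A}" "finite {w. (w, v) \<in> A}" using fin finite_subset by blast+
    show "{w. (v, w) \<in> A} \<inter> {w. (w, v) \<in> A} = {}" using anti E by blast
  qed
  finally show ?thesis .
qed

lemma spiral_orientation_iff:
  "0 < d \<Longrightarrow> (v, v + d) \<in> spiral_orientation ts \<longleftrightarrow> spiral_edge (length ts) v (v + d) \<and> forward ts v d"
  "0 < d \<Longrightarrow> (v + d, v) \<in> spiral_orientation ts \<longleftrightarrow> spiral_edge (length ts) v (v + d) \<and> \<not> forward ts v d"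
  by (auto simp: spiral_orientation_def spiral_edge_def)

lemma spiral_orientation_minus:
  "0 < d \<Longrightarrow> d \<le> v \<Longrightarrow> (v, v - d) \<in> spiral_orientation ts \<longleftrightarrow>
    spiral_edge (length ts) (v - d) v \<and> \<not> forward ts (v - d) d"
  "0 < d \<Longrightarrow> d \<le> v \<Longrightarrow> (v - d, v) \<in> spiral_orientation ts \<longleftrightarrow>
    spiral_edge (length ts) (v - d) v \<and> forward ts (v - d) d"
  using spiral_orientation_iff[of d "v - d" ts] by simp_all

lemma orientation_spiral: "orientation (spiral_map (length ts)) (spiral_orientation ts)"
  unfolding orientation_def
proof (intro conjI allI impI ballI)
  fix x assume "x \<in> spiral_orientation ts"
  then show "case x of (u, v) \<Rightarrow> {u, v} \<in> edges (spiral_map (length ts))"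
    by (auto simp: spiral_orientation_def spiral_map_def insert_commute)
next
  fix u v assume "{u, v} \<in> edges (spiral_map (length ts))"
  then have "spiral_edge (length ts) u v \<or> spiral_edge (length ts) v u"
    by (auto simp: spiral_map_def doubleton_eq_iff)
  then show "(u, v) \<in> spiral_orientation ts \<longleftrightarrow> (v, u) \<notin> spiral_orientation ts"
    by (auto simp: spiral_orientation_def spiral_edge_def)
qed

lemma of_bool_balance:
  assumes "of_bool p1 + of_bool p2 + of_bool p3 = of_bool q1 + of_bool q2 + (of_bool q3 :: nat)"
  shows "of_bool p1 + of_bool p2 + of_bool p3 + of_bool (\<not> q1) + of_bool (\<not> q2) + of_bool (\<not> q3)
    = of_bool (\<not> p1) + of_bool (\<not> p2) + of_bool (\<not> p3) + of_bool q1 + of_bool q2 + (of_bool q3 :: nat)"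
  using assms by (cases p1; cases p2; cases p3; cases q1; cases q2; cases q3) simp_all

text \<open>
  At an inner vertex, balance is the rule for the choices in a walk.  At the last three vertices it follows
  from the final state \<open>(1, 1, 1)\<close>, at the first three from the fixed choices.
\<close>

lemma spiral_orientation_balanced:
  assumes run: "flow_run (2, 1, 0) ts" and v: "v < length ts + 6"
  shows "card {w. (v, w) \<in> spiral_orientation ts} = card {w. (w, v) \<in> spiral_orientation ts}"
proof -
  let ?m = "length ts" and ?A = "spiral_orientation ts"
  have out: "card {w. (v, w) \<in> ?A} =
      of_bool (spiral_edge ?m v (v + 1) \<and> forward ts v 1) + of_bool (spiral_edge ?m v (v + 2) \<and> forward ts v 2)
      + of_bool (spiral_edge ?m v (v + 3) \<and> forward ts v 3)
      + of_bool (1 \<le> v \<and> spiral_edge ?m (v - 1) v \<and> \<not> forward ts (v - 1) 1)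
      + of_bool (2 \<le> v \<and> spiral_edge ?m (v - 2) v \<and> \<not> forward ts (v - 2) 2)
      + of_bool (3 \<le> v \<and> spiral_edge ?m (v - 3) v \<and> \<not> forward ts (v - 3) 3)"
    by (subst card_near[of _ v])
      (auto simp: spiral_orientation_iff spiral_orientation_minus cong: conj_cong,
        auto simp: spiral_orientation_def spiral_edge_def)
  have into: "card {w. (w, v) \<in> ?A} =
      of_bool (spiral_edge ?m v (v + 1) \<and> \<not> forward ts v 1) + of_bool (spiral_edge ?m v (v + 2) \<and> \<not> forward ts v 2)
      + of_bool (spiral_edge ?m v (v + 3) \<and> \<not> forward ts v 3)
      + of_bool (1 \<le> v \<and> spiral_edge ?m (v - 1) v \<and> forward ts (v - 1) 1)
      + of_bool (2 \<le> v \<and> spiral_edge ?m (v - 2) v \<and> forward ts (v - 2) 2)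
      + of_bool (3 \<le> v \<and> spiral_edge ?m (v - 3) v \<and> forward ts (v - 3) 3)"
    by (subst card_near[of _ v])
      (auto simp: spiral_orientation_iff spiral_orientation_minus cong: conj_cong,
        auto simp: spiral_orientation_def spiral_edge_def)
  have last: "of_bool (forward ts (?m + 2) 1) + of_bool (forward ts (?m + 1) 2) + of_bool (forward ts ?m 3) = (1::nat)"
    "of_bool (forward ts (?m + 2) 2) + of_bool (forward ts (?m + 1) 3) = (1::nat)"
    "forward ts (?m + 2) 3"
    using flow_run_balance(2)[OF run] by (simp_all add: flow_at_def del: One_nat_def)
  have start: "forward ts 0 1" "\<not> forward ts 0 2" "\<not> forward ts 0 3" "forward ts 1 1" "forward ts 1 2" "\<not> forward ts 1 3"
    "forward ts 2 1" "forward ts 2 2" "\<not> forward ts 2 3"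
    by (simp_all add: forward_bits choice_at_def del: One_nat_def)
  have stop: "\<not> forward ts (?m + 3) d" "\<not> forward ts (?m + 4) d" "\<not> forward ts (?m + 5) d" for d
    by (simp_all add: forward_def choice_at_def)
  then have stop': "forward ts (?m + 3) d = False" "forward ts (?m + 4) d = False" for d by simp_all
  consider "v = 0" | "v = 1" | "v = 2" | k where "v = k + 3" "k < ?m" | "v = ?m + 3" | "v = ?m + 4" | "v = ?m + 5"
  proof -
    have "v = 0 \<or> v = 1 \<or> v = 2 \<or> (v = (v - 3) + 3 \<and> v - 3 < ?m) \<or> v = ?m + 3 \<or> v = ?m + 4 \<or> v = ?m + 5"
      using v by linarith
    then show thesis using that by blast
  qed
  then show ?thesis
  proof cases
    case 1
    then show ?thesis unfolding out into using start by (simp add: spiral_edge_def)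
  next
    case 2
    then show ?thesis unfolding out into using start by (simp add: spiral_edge_def)
  next
    case 3
    then show ?thesis unfolding out into using start by (simp add: spiral_edge_def)
  next
    case (4 k)
    have bal: "of_bool (forward ts v 1) + of_bool (forward ts v 2) + of_bool (forward ts v 3)
      = of_bool (forward ts (k + 2) 1) + of_bool (forward ts (k + 1) 2) + (of_bool (forward ts k 3) :: nat)"
      using flow_run_balance(1)[OF run 4(2)] unfolding count_out_forward 4(1) by (simp add: flow_at_def)
    have e: "spiral_edge ?m v (v + 1)" "spiral_edge ?m v (v + 2)" "spiral_edge ?m v (v + 3)"
      "spiral_edge ?m (k + 2) v" "spiral_edge ?m (k + 1) v" "spiral_edge ?m k v"
      and le: "1 \<le> v" "2 \<le> v" "3 \<le> v" and minus: "v - 1 = k + 2" "v - 2 = k + 1" "v - 3 = k"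
      using 4 by (auto simp: spiral_edge_def)
    show ?thesis unfolding out into minus simp_thms eqTrueI[OF e(1)] eqTrueI[OF e(2)] eqTrueI[OF e(3)]
        eqTrueI[OF e(4)] eqTrueI[OF e(5)] eqTrueI[OF e(6)] eqTrueI[OF le(1)] eqTrueI[OF le(2)] eqTrueI[OF le(3)]
      by (rule of_bool_balance[OF bal])
  next
    case 5
    have e: "spiral_edge ?m v (v + 1) = True" "spiral_edge ?m v (v + 2) = False" "spiral_edge ?m v (v + 3) = False"
      "spiral_edge ?m (?m + 2) v = True" "spiral_edge ?m (?m + 1) v = True" "spiral_edge ?m ?m v = True"
      and le: "(1 \<le> v) = True" "(2 \<le> v) = True" "(3 \<le> v) = True"
      and minus: "v - 1 = ?m + 2" "v - 2 = ?m + 1" "v - 3 = ?m"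
      using 5 by (auto simp: spiral_edge_def)
    have no: "forward ts v d = False" for d using stop 5 by auto
    show ?thesis unfolding out into minus e le no stop' simp_thms of_bool_eq
      using last(1)
      by (cases "forward ts (?m + 2) 1"; cases "forward ts (?m + 1) 2"; cases "forward ts ?m 3") simp_all
  next
    case 6
    have e: "spiral_edge ?m v (v + 1) = True" "spiral_edge ?m v (v + 2) = False" "spiral_edge ?m v (v + 3) = False"
      "spiral_edge ?m (?m + 3) v = True" "spiral_edge ?m (?m + 2) v = True" "spiral_edge ?m (?m + 1) v = True"
      and le: "(1 \<le> v) = True" "(2 \<le> v) = True" "(3 \<le> v) = True"
      and minus: "v - 1 = ?m + 3" "v - 2 = ?m + 2" "v - 3 = ?m + 1"
      using 6 by (auto simp: spiral_edge_def)
    have no: "forward ts v d = False" for d using stop 6 by auto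
    show ?thesis unfolding out into minus e le no stop' simp_thms of_bool_eq
      using last(2)
      by (cases "forward ts (?m + 2) 2"; cases "forward ts (?m + 1) 3") simp_all
  next
    case 7
    have e: "spiral_edge ?m v (v + 1) = False" "spiral_edge ?m v (v + 2) = False" "spiral_edge ?m v (v + 3) = False"
      "spiral_edge ?m (?m + 4) v = True" "spiral_edge ?m (?m + 3) v = False" "spiral_edge ?m (?m + 2) v = True"
      and le: "(1 \<le> v) = True" "(2 \<le> v) = True" "(3 \<le> v) = True"
      and minus: "v - 1 = ?m + 4" "v - 2 = ?m + 3" "v - 3 = ?m + 2"
      using 7 by (auto simp: spiral_edge_def)
    have no: "forward ts v d = False" for d using stop 7 by auto
    show ?thesis unfolding out into minus e le no stop' simp_thms of_bool_eq
      using last(3) by simp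
  qed
qed

lemma spiral_orientation_eulerian:
  assumes "ts \<in> flow_runs m (2, 1, 0)"
  shows "spiral_orientation ts \<in> eulerian_orientations (spiral_map m)"
proof -
  have m: "length ts = m" "flow_run (2, 1, 0) ts" using assms by (simp_all add: flow_runs_def)
  have pm: "is_planar_map (spiral_map m)" using spiral_map_planar[of m] by (simp add: planar_maps_def)
  have o: "orientation (spiral_map m) (spiral_orientation ts)" using orientation_spiral[of ts] m by simp
  have "real (out_degree (spiral_orientation ts) v) = real (vertex_degree (spiral_map m) v) / 2"
    if "v \<in> verts (spiral_map m)" for v
    using spiral_orientation_balanced[OF m(2), of v] that m(1) orientation_vertex_degree[OF pm o, of v]
    by (simp add: out_degree_def spiral_map_def)
  then show ?thesis using o by (simp add: eulerian_orientations_def)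
qed

text \<open>
  All edges from a vertex \<open>k + 3\<close> with \<open>k < m\<close> to its three successors are present, so the choices can be read off.
\<close>

lemma inj_spiral_orientation: "inj_on spiral_orientation (flow_runs m s)"
proof (rule inj_onI)
  fix ts us assume ts: "ts \<in> flow_runs m s" and us: "us \<in> flow_runs m s"
    and eq: "spiral_orientation ts = spiral_orientation us"
  have len: "length ts = m" "length us = m" using ts us by (simp_all add: flow_runs_def)
  show "ts = us"
  proof (rule nth_equalityI)
    show "length ts = length us" using len by simp
    fix k assume "k < length ts"
    then have k: "k < m" using len by simp
    have fwd: "forward ts (k + 3) d = forward us (k + 3) d" if "d = 1 \<or> d = 2 \<or> d = 3" for d
    proof -
      have "spiral_edge m (k + 3) (k + 3 + d)" "0 < d" using that k by (auto simp: spiral_edge_def)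
      then show ?thesis using spiral_orientation_iff(1)[of d "k + 3"] len eq by metis
    qed
    have "choice_at ts (k + 3) = choice_at us (k + 3)"
      using fwd[of 1] fwd[of 2] fwd[of 3] unfolding forward_bits by (simp add: prod_eq_iff)
    then show "ts ! k = us ! k" using k len by (simp add: choice_at_def)
  qed
qed

lemma max_eulerian_orientations_ge: "2.7 ^ m \<le> real (max_eulerian_orientations (m + 8))"
proof -
  let ?M = "spiral_map (m + 2)"
  have pm: "?M \<in> planar_maps (m + 8)" using spiral_map_planar[of "m + 2"] by (simp add: numeral_eq_Suc)
  then have "is_planar_map ?M" by (simp add: planar_maps_def)
  then have fin: "finite (eulerian_orientations ?M)"
    using eulerian_orientations_subset[of ?M]
    by (intro finite_subset[OF eulerian_orientations_subset]) (auto simp: is_planar_map_def simple_graph_def)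
  have "2.7 ^ m \<le> real (card (flow_runs (m + 2) (2, 1, 0)))" using card_flow_runs_ge(2)[of m] by (simp add: numeral_2_eq_2)
  also have "card (flow_runs (m + 2) (2, 1, 0)) = card (spiral_orientation ` flow_runs (m + 2) (2, 1, 0))"
    by (rule card_image[OF inj_spiral_orientation, symmetric])
  also have "\<dots> \<le> card (eulerian_orientations ?M)"
    using spiral_orientation_eulerian by (intro card_mono fin) blast
  also have "\<dots> \<le> max_eulerian_orientations (m + 8)"
    unfolding max_eulerian_orientations_def
    by (rule Max_ge[OF finite_eulerian_orientation_numbers]) (use pm in blast)
  finally show ?thesis by simp
qed

section \<open>The growth rate\<close>

theorem theorem2:
  "\<forall>\<^sub>F n in sequentially.
     (2.59 :: real) ^ n \<le> real (max_eulerian_orientations n) \<and>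
     real (max_eulerian_orientations n) \<le> (3.73 :: real) ^ n"
proof -
  have upper: "real (max_eulerian_orientations n) \<le> 3.73 ^ n" for n
  proof -
    have "max_eulerian_orientations n \<in> (\<lambda>M. card (eulerian_orientations M)) ` planar_maps n"
      unfolding max_eulerian_orientations_def
      using planar_maps_nonempty finite_eulerian_orientation_numbers by (intro Max_in) auto
    then show ?thesis using card_eulerian_orientations_le by auto
  qed
  \<comment> \<open>the growth starts eight vertices late; this costs a constant factor, which the surplus of 2.7 over 2.59 recovers\<close>
  obtain N where N: "(2.7 :: real) ^ 8 < (2.7 / 2.59) ^ N"
    using real_arch_pow[of "2.7 / 2.59 :: real" "2.7 ^ 8"] by auto
  have lower: "(2.59 :: real) ^ n \<le> real (max_eulerian_orientations n)" if "max N 8 \<le> n" for n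
  proof -
    have "(2.7 / 2.59 :: real) ^ N \<le> (2.7 / 2.59) ^ n"
      using that by (intro power_increasing) simp_all
    with N have "(2.7 :: real) ^ 8 \<le> (2.7 / 2.59) ^ n" by (rule order.trans[OF less_imp_le])
    then have "(2.59 :: real) ^ n * 2.7 ^ 8 \<le> 2.59 ^ n * (2.7 / 2.59) ^ n" by (intro mult_left_mono) simp_all
    also have "\<dots> = (2.7 :: real) ^ n" by (simp flip: power_mult_distrib)
    also have "(2.7 :: real) ^ n = 2.7 ^ (n - 8) * 2.7 ^ 8"
      using that by (simp flip: power_add)
    finally have "(2.59 :: real) ^ n \<le> 2.7 ^ (n - 8)" by (rule mult_right_le_imp_le) simp
    also have "\<dots> \<le> real (max_eulerian_orientations n)"
      using max_eulerian_orientations_ge[of "n - 8"] that by simp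
    finally show ?thesis .
  qed
  show ?thesis
    using eventually_ge_at_top[of "max N 8"] by eventually_elim (use upper lower in auto)
qed

end
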